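(* Let $d\ge1$, let $\alpha$ be in the $H^2$-subcritical range ($\alpha>0$ if $d\le4$, $0<\alpha<\frac8{d-4}$ if $d\ge5$), and let $\mathcal X\subset H^2(\mathbb R^d)$ be a symmetry class. Assume that, for some $\epsilon_0>0$, the infimum defining $\mathcal R_\epsilon^{\mathcal X}(\alpha)$ is attained for every $\epsilon\in(0,\epsilon_0)$. For each such $\epsilon$ let $v_\epsilon\in\mathcal X$ be an optimizer normalized by $\|v_\epsilon\|_{L^{\alpha+2}(\mathbb R^d)}=1$, and define $Q_\epsilon^{\mathcal X}=\big(\mathcal R_\epsilon^{\mathcal X}(\alpha)\big)^{1/\alpha}v_\epsilon$. Then: (i) The map $\epsilon\mapsto\mathcal R_\epsilon^{\mathcal X}(\alpha)$ is increasing and concave on $(0,\epsilon_0)$, and for $0<\epsilon_1<\epsilon_2<\epsilon_0$ $$M(v_{\epsilon_2})\le\frac{\mathcal R_{\epsilon_2}^{\mathcal X}(\alpha)-\mathcal R_{\epsilon_1}^{\mathcal X}(\alpha)}{\epsilon_2-\epsilon_1}\le M(v_{\epsilon_1}).$$ In particular, $M(v_\epsilon)$ is nonincreasing in $\epsilon$, and at every point where $\epsilon\mapsto\mathcal R_\epsilon^{\mathcal X}(\alpha)$ is differentiable, $$\frac{d}{d\epsilon}\mathcal R_\epsilon^{\mathcal X}(\alpha)=M(v_\epsilon)\quad\text{and}\quad\frac{d}{d\epsilon}S_{1+\epsilon}\big(Q_\epsilon^{\mathcal X}\big)=\frac12M\big(Q_\epsilon^{\mathcal X}\big).$$ (ii)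 If for some $0<\gamma<1$ one has $\mathcal R_\epsilon^{\mathcal X}(\alpha)\approx\epsilon^\gamma L(\epsilon)$, where $L>0$ is slowly varying at $0$ (i.e. $L(\lambda\epsilon)/L(\epsilon)\to1$ as $\epsilon\to0^+$ for each fixed $\lambda>0$), then $$M\big(Q_\epsilon^{\mathcal X}\big)\approx\frac{\big(\mathcal R_\epsilon^{\mathcal X}(\alpha)\big)^{\frac{\alpha+2}{\alpha}}}{\epsilon}\approx\epsilon^{\gamma\frac{\alpha+2}{\alpha}-1}L(\epsilon)^{\frac{\alpha+2}{\alpha}}.$$ (iii) If, in addition to the hypothesis of (ii), $\mathcal R_{\lambda\epsilon}^{\mathcal X}(\alpha)/\mathcal R_\epsilon^{\mathcal X}(\alpha)\to\lambda^\gamma$ as $\epsilon\to0^+$ for each fixed $\lambda>0$, then as $\epsilon\to0^+$ $$\epsilon\,M\big(Q_\epsilon^{\mathcal X}\big)=\gamma\,\big(\mathcal R_\epsilon^{\mathcal X}(\alpha)\big)^{\frac{\alpha+2}{\alpha}}(1+o(1)),$$ and $$\epsilon\,M\big(Q_\epsilon^{\mathcal X}\big)=\gamma\,\big\|Q_\epsilon^{\mathcal X}\big\|_{L^{\alpha+2}}^{\alpha+2}(1+o(1)),\qquad q_{1,1}\big(Q_\epsilon^{\mathcal X}\big)=(1-\gamma)\,\big\|Q_\epsilon^{\mathcal X}\big\|_{L^{\alpha+2}}^{\alpha+2}(1+o(1)).$$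
   Context: For $u\in H^2(\mathbb R^d)$ put $M(u)=\|u\|_{L^2(\mathbb R^d)}^2$ and $$q_{1,1}(u)=\int_{\mathbb R^d}(|\xi|^2-1)^2|\hat u(\xi)|^2\,d\xi=\|\Delta u+u\|_{L^2}^2$$ (unitary Fourier transform). A symmetry class $\mathcal X$ is either the whole space $H^2(\mathbb R^d)$ or a symmetry subspace of it, such as the radial functions $H^2_{\rm rad}(\mathbb R^d)$ or the block-radial functions, i.e. those invariant under $O(d-k)\times O(k)$ acting on $\mathbb R^{d-k}\times\mathbb R^k$. For $\epsilon>0$, $$\mathcal R_\epsilon^{\mathcal X}(\alpha)=\inf_{u\in\mathcal X\setminus\{0\}}\frac{q_{1,1}(u)+\epsilon M(u)}{\|u\|_{L^{\alpha+2}(\mathbb R^d)}^2}.$$ The action is $$S_{1+\epsilon}(u)=\frac12\|\Delta u\|_{L^2}^2-\|\nabla u\|_{L^2}^2+\frac{1+\epsilon}{2}\|u\|_{L^2}^2-\frac1{\alpha+2}\|u\|_{L^{\alpha+2}}^{\alpha+2}.$$ $A_\epsilon\approx B_\epsilon$ means: there are constants $0<c<C<\infty$ independent of $\epsilon$ with $cB_\epsilon\le A_\epsilon\le CB_\epsilon$ for all sufficiently small $\epsilon>0$. *)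

theory Defs
  imports "HOL-Analysis.Analysis" "HOL-Library.Landau_Symbols"
begin

text \<open>
  The space R^d is a type \<open>'a::euclidean_space\<close> with \<open>d = DIM('a)\<close>. Elements of Lebesgue and
  Sobolev spaces are Borel measurable functions \<open>'a \<Rightarrow> complex\<close>, identified when they agree
  almost everywhere.
\<close>

subsection \<open>Weak derivatives and the Sobolev space \<open>H\<^sup>2\<close>\<close>

primrec Ck :: "nat \<Rightarrow> ('a::euclidean_space \<Rightarrow> real) \<Rightarrow> bool" where
  "Ck 0 f \<longleftrightarrow> continuous_on UNIV f"
| "Ck (Suc k) f \<longleftrightarrow> f differentiable_on UNIV \<and>
     (\<forall>i\<in>Basis. Ck k (\<lambda>x. frechet_derivative f (at x) i))"

definition test_function :: "('a::euclidean_space \<Rightarrow> real) \<Rightarrow> bool" where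
  "test_function \<phi> \<longleftrightarrow> (\<forall>k. Ck k \<phi>) \<and> compact (closure {x. \<phi> x \<noteq> 0})"

definition L2_fun :: "('a::euclidean_space \<Rightarrow> complex) \<Rightarrow> bool" where
  "L2_fun u \<longleftrightarrow> u \<in> borel_measurable lborel \<and> integrable lborel (\<lambda>x. (norm (u x))\<^sup>2)"

definition has_weak_deriv ::
  "'a::euclidean_space \<Rightarrow> ('a \<Rightarrow> complex) \<Rightarrow> ('a \<Rightarrow> complex) \<Rightarrow> bool" where
  "has_weak_deriv i u g \<longleftrightarrow> L2_fun u \<and> L2_fun g \<and>
     (\<forall>\<phi>. test_function \<phi> \<longrightarrow>
        (\<integral>x. frechet_derivative \<phi> (at x) i *\<^sub>R u x \<partial>lborel) = - (\<integral>x. \<phi> x *\<^sub>R g x \<partial>lborel))"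

text \<open>The weak derivative is determined up to a null set; a representative is chosen.\<close>

definition wderiv :: "'a::euclidean_space \<Rightarrow> ('a \<Rightarrow> complex) \<Rightarrow> 'a \<Rightarrow> complex" where
  "wderiv i u = (SOME g. has_weak_deriv i u g)"

definition H2 :: "('a::euclidean_space \<Rightarrow> complex) set" where
  "H2 = {u. L2_fun u \<and> (\<forall>i\<in>Basis. (\<exists>g. has_weak_deriv i u g) \<and>
              (\<forall>j\<in>Basis. \<exists>h. has_weak_deriv j (wderiv i u) h))}"

definition laplacian :: "('a::euclidean_space \<Rightarrow> complex) \<Rightarrow> 'a \<Rightarrow> complex" where
  "laplacian u x = (\<Sum>i\<in>Basis. wderiv i (wderiv i u) x)"

subsection \<open>The functionals\<close>

text \<open>
  The integral is the Bochner integral, which is 0 for non-integrable functions. Under the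
  subcriticality assumption this is harmless: \<open>H\<^sup>2\<close> embeds into the Lebesgue space of exponent
  \<open>\<alpha> + 2\<close>.
\<close>

definition Lp_norm :: "real \<Rightarrow> ('a::euclidean_space \<Rightarrow> complex) \<Rightarrow> real" where
  "Lp_norm p u = (\<integral>x. norm (u x) powr p \<partial>lborel) powr (1 / p)"

definition mass :: "('a::euclidean_space \<Rightarrow> complex) \<Rightarrow> real" where
  "mass u = (Lp_norm 2 u)\<^sup>2"

definition q11 :: "('a::euclidean_space \<Rightarrow> complex) \<Rightarrow> real" where
  "q11 u = (Lp_norm 2 (\<lambda>x. laplacian u x + u x))\<^sup>2"

definition grad_norm :: "('a::euclidean_space \<Rightarrow> complex) \<Rightarrow> real" where
  "grad_norm u = sqrt (\<integral>x. (\<Sum>i\<in>Basis. (norm (wderiv i u x))\<^sup>2) \<partial>lborel)"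

definition action :: "real \<Rightarrow> real \<Rightarrow> ('a::euclidean_space \<Rightarrow> complex) \<Rightarrow> real" where
  "action \<alpha> \<omega> u = 1 / 2 * (Lp_norm 2 (laplacian u))\<^sup>2 - (grad_norm u)\<^sup>2
     + \<omega> / 2 * (Lp_norm 2 u)\<^sup>2 - 1 / (\<alpha> + 2) * Lp_norm (\<alpha> + 2) u powr (\<alpha> + 2)"

subsection \<open>Symmetry classes\<close>

definition orthogonal_subgroup :: "('a::euclidean_space \<Rightarrow> 'a) set \<Rightarrow> bool" where
  "orthogonal_subgroup G \<longleftrightarrow> G \<subseteq> Collect orthogonal_transformation \<and> id \<in> G \<and>
     (\<forall>g\<in>G. \<forall>h\<in>G. g \<circ> h \<in> G) \<and> (\<forall>g\<in>G. inv g \<in> G)"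

definition H2_invariant :: "('a::euclidean_space \<Rightarrow> 'a) set \<Rightarrow> ('a \<Rightarrow> complex) set" where
  "H2_invariant G = {u \<in> H2. \<forall>g\<in>G. AE x in lborel. u (g x) = u x}"

definition symmetry_class :: "('a::euclidean_space \<Rightarrow> complex) set \<Rightarrow> bool" where
  "symmetry_class X \<longleftrightarrow> (\<exists>G. orthogonal_subgroup G \<and> X = H2_invariant G)"

definition H2_rad :: "('a::euclidean_space \<Rightarrow> complex) set" where
  "H2_rad = H2_invariant (Collect orthogonal_transformation)"

text \<open>
  For \<open>B \<subseteq> Basis\<close> with \<open>k\<close> elements, an orthogonal map leaving \<open>span B\<close> invariant also leaves its
  orthogonal complement invariant, so these maps form the group O(d-k) x O(k).
\<close>

definition H2_block_rad :: "'a::euclidean_space set \<Rightarrow> ('a \<Rightarrow> complex) set" where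
  "H2_block_rad B = H2_invariant {g. orthogonal_transformation g \<and> g ` span B = span B}"

lemma symmetry_class_H2: "symmetry_class H2"
  unfolding symmetry_class_def
  by (rule exI[of _ "{id}"])
     (auto simp: orthogonal_subgroup_def H2_invariant_def id_def)

lemma symmetry_class_rad: "symmetry_class H2_rad"
  unfolding symmetry_class_def H2_rad_def orthogonal_subgroup_def
  by (rule exI[of _ "Collect orthogonal_transformation"])
     (auto simp: id_def orthogonal_transformation_inv intro: orthogonal_transformation_compose)

lemma symmetry_class_block_rad: "symmetry_class (H2_block_rad B)"
proof -
  have "inv g ` span B = span B"
    if "orthogonal_transformation g" "g ` span B = span B" for g :: "'a \<Rightarrow> 'a"
    using that by (metis bij_def image_inv_f_f orthogonal_transformation_bij)
  moreover have "(g \<circ> h) ` span B = span B"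
    if "g ` span B = span B" "h ` span B = span B" for g h :: "'a \<Rightarrow> 'a"
    using that by (metis image_comp)
  moreover have "orthogonal_transformation (g \<circ> h)"
    if "orthogonal_transformation g" "orthogonal_transformation h" for g h :: "'a \<Rightarrow> 'a"
    using that by (rule orthogonal_transformation_compose)
  moreover have "orthogonal_transformation (id :: 'a \<Rightarrow> 'a)"
    by (simp add: id_def)
  ultimately have "orthogonal_subgroup {g. orthogonal_transformation g \<and> g ` span B = span B}"
    unfolding orthogonal_subgroup_def by (simp add: orthogonal_transformation_inv Collect_mono)
  then show ?thesis
    unfolding symmetry_class_def H2_block_rad_def by blast
qed

subsection \<open>The minimization problem\<close>

definition nonzero :: "('a::euclidean_space \<Rightarrow> complex) \<Rightarrow> bool" where
  "nonzero u \<longleftrightarrow> \<not> (AE x in lborel. u x = 0)"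

definition quotient :: "real \<Rightarrow> real \<Rightarrow> ('a::euclidean_space \<Rightarrow> complex) \<Rightarrow> real" where
  "quotient \<alpha> \<epsilon> u = (q11 u + \<epsilon> * mass u) / (Lp_norm (\<alpha> + 2) u)\<^sup>2"

definition Rinf :: "('a::euclidean_space \<Rightarrow> complex) set \<Rightarrow> real \<Rightarrow> real \<Rightarrow> real" where
  "Rinf X \<alpha> \<epsilon> = (INF u \<in> {u \<in> X. nonzero u}. quotient \<alpha> \<epsilon> u)"

definition optimizer ::
  "('a::euclidean_space \<Rightarrow> complex) set \<Rightarrow> real \<Rightarrow> real \<Rightarrow> ('a \<Rightarrow> complex) \<Rightarrow> bool" where
  "optimizer X \<alpha> \<epsilon> u \<longleftrightarrow> u \<in> X \<and> nonzero u \<and> quotient \<alpha> \<epsilon> u = Rinf X \<alpha> \<epsilon>"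

definition rescaled ::
  "('a::euclidean_space \<Rightarrow> complex) set \<Rightarrow> real \<Rightarrow> (real \<Rightarrow> 'a \<Rightarrow> complex) \<Rightarrow> real \<Rightarrow> 'a \<Rightarrow> complex" where
  "rescaled X \<alpha> v \<epsilon> = (\<lambda>x. (Rinf X \<alpha> \<epsilon> powr (1 / \<alpha>)) *\<^sub>R v \<epsilon> x)"

subsection \<open>Asymptotic notions at \<open>0\<^sup>+\<close>\<close>

definition comparable :: "(real \<Rightarrow> real) \<Rightarrow> (real \<Rightarrow> real) \<Rightarrow> bool" (infix \<open>\<approx>\<close> 50) where
  "A \<approx> B \<longleftrightarrow> (\<exists>c C. 0 < c \<and> c < C \<and>
     (\<forall>\<^sub>F \<epsilon> in at_right 0. c * B \<epsilon> \<le> A \<epsilon> \<and> A \<epsilon> \<le> C * B \<epsilon>))"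

definition slowly_varying_at_0 :: "(real \<Rightarrow> real) \<Rightarrow> bool" where
  "slowly_varying_at_0 L \<longleftrightarrow> (\<forall>\<^sub>F \<epsilon> in at_right 0. 0 < L \<epsilon>) \<and>
     (\<forall>t>0. ((\<lambda>\<epsilon>. L (t * \<epsilon>) / L \<epsilon>) \<longlongrightarrow> 1) (at_right 0))"

end

theory Submission
  imports Defs "HOL-Computational_Algebra.Polynomial" "HOL-Real_Asymp.Real_Asymp"
begin

text \<open>
  Testing the infimum at \<open>\<epsilon>'\<close> with the optimizer at \<open>\<epsilon>\<close> gives
  \<open>R \<epsilon>' \<le> R \<epsilon> + (\<epsilon>' - \<epsilon>) * M (v \<epsilon>)\<close>: the mass of the optimizer is a supergradient of \<open>R\<close>. Together
  with \<open>0 < \<epsilon> * M (v \<epsilon>) \<le> R \<epsilon>\<close> this one inequality yields the monotonicity and concavity claims, and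
  the asymptotics follow by comparing \<open>R\<close> at \<open>\<epsilon>\<close> and at a fixed multiple of \<open>\<epsilon>\<close>.

  The analytic input is that the functionals scale under multiplication by constants, which for
  weak derivatives (chosen representatives) needs their uniqueness, and the identity
  \<open>q (u) = \<parallel>\<Delta>u\<parallel>\<^sup>2 - 2 \<parallel>\<nabla>u\<parallel>\<^sup>2 + \<parallel>u\<parallel>\<^sup>2\<close>, that is, integration by parts between two weakly differentiable
  functions. For the latter, smear \<open>\<integral> h(x + z) \<bullet> u(x) + w(x + z) \<bullet> g(x) dx\<close> in \<open>z\<close> against a test function
  \<open>\<rho>\<close>: by Fubini the derivative moves through \<open>\<rho>\<close> and the result is 0. So this function of \<open>z\<close> vanishes
  almost everywhere, and by continuity of translations in \<open>L\<^sup>2\<close> also at \<open>z = 0\<close>.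
\<close>

subsection \<open>Test functions\<close>

lemma Ck_Suc_imp: "Ck (Suc k) f \<Longrightarrow> Ck k f"
proof (induction k arbitrary: f)
  case 0
  then show ?case by (simp add: differentiable_imp_continuous_on)
qed auto

lemma Ck_add:
  fixes f g :: "'a::euclidean_space \<Rightarrow> real"
  shows "Ck k f \<Longrightarrow> Ck k g \<Longrightarrow> Ck k (\<lambda>x. f x + g x)"
proof (induction k arbitrary: f g)
  case 0
  then show ?case by (simp add: continuous_on_add)
next
  case (Suc k)
  have d: "f differentiable at x" "g differentiable at x" for x
    using Suc.prems by (auto simp: differentiable_on_def)
  have eq: "frechet_derivative (\<lambda>x. f x + g x) (at x) i
      = frechet_derivative f (at x) i + frechet_derivative g (at x) i" for x i
    using frechet_derivative_at[OF has_derivative_add[OF d[THEN frechet_derivative_works[THEN iffD1]]],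
        of x, symmetric]
    by simp
  show ?case
    using Suc d unfolding Ck.simps eq by (auto simp: differentiable_on_def)
qed

lemma Ck_mult:
  fixes f g :: "'a::euclidean_space \<Rightarrow> real"
  shows "Ck k f \<Longrightarrow> Ck k g \<Longrightarrow> Ck k (\<lambda>x. f x * g x)"
proof (induction k arbitrary: f g)
  case 0
  then show ?case by (simp add: continuous_on_mult)
next
  case (Suc k)
  have d: "f differentiable at x" "g differentiable at x" for x
    using Suc.prems by (auto simp: differentiable_on_def)
  have eq: "frechet_derivative (\<lambda>x. f x * g x) (at x) i
      = f x * frechet_derivative g (at x) i + frechet_derivative f (at x) i * g x" for x i
    using frechet_derivative_at[OF has_derivative_mult[OF d[THEN frechet_derivative_works[THEN iffD1]]],
        of x, symmetric]
    by simp
  \<comment> \<open>Each summand of the product rule keeps one undifferentiated factor, known to be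
    \<open>Ck (Suc k)\<close>; it is lowered to \<open>Ck k\<close> to meet the induction
    hypothesis.\<close>
  have "Ck k (\<lambda>x. f x * frechet_derivative g (at x) i + frechet_derivative f (at x) i * g x)"
    if "i \<in> Basis" for i
    using Suc that by (intro Ck_add Suc.IH) (auto intro: Ck_Suc_imp)
  then show ?case
    using d unfolding Ck.simps eq by (auto simp: differentiable_on_def)
qed

lemma Ck_const: "Ck k (\<lambda>x. c)"
  by (induction k arbitrary: c) auto

lemma Ck_prod:
  fixes f :: "'i \<Rightarrow> 'a::euclidean_space \<Rightarrow> real"
  assumes "finite I" "\<And>i. i \<in> I \<Longrightarrow> Ck k (f i)"
  shows "Ck k (\<lambda>x. \<Prod>i\<in>I. f i x)"
  using assms by (induction I rule: finite_induct) (auto intro: Ck_const Ck_mult)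

section \<open>Smooth bump functions built from \<open>exp (- (1 / t))\<close>\<close>

definition flat :: "real poly \<Rightarrow> real \<Rightarrow> real" where
  "flat p t = (if t \<le> 0 then 0 else poly p (1 / t) * exp (- (1 / t)))"

lemma poly_exp_decay: "((\<lambda>s::real. s * poly p s * exp (- s)) \<longlongrightarrow> 0) at_top"
proof -
  \<comment> \<open>The power of s is generalized because
    \<open>poly (pCons a p) s = a + s * poly p s\<close> moves one factor s into it. Only n = 1 is
    wanted: that factor is the 1/h of a difference quotient at 0.\<close>
  have "((\<lambda>s::real. s ^ n * poly p s * exp (- s)) \<longlongrightarrow> 0) at_top" for n
  proof (induction p arbitrary: n)
    case (pCons a p)
    have "((\<lambda>s. a * (s ^ n * exp (- s)) + s ^ Suc n * poly p s * exp (- s)) \<longlongrightarrow> a * 0 + 0) at_top"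
      using tendsto_power_div_exp_0[of n]
      by (intro tendsto_add tendsto_mult tendsto_const pCons.IH)
         (simp add: exp_minus field_simps)
    then show ?case by (simp add: algebra_simps)
  qed auto
  from this[of 1] show ?thesis by simp
qed

text \<open>The polynomial factor makes the family \<open>flat p\<close> closed under
  differentiation. With s = 1/t one has ds/dt = -s^2, so p(s) exp(-s) differentiates to s^2 (p -
  p')(s) exp(-s), and \<open>[:0, 0, 1:]\<close> is s^2. At t = 0 both one-sided difference
  quotients tend to 0, the right one because exp(-s) beats every polynomial.\<close>

lemma flat_has_derivative:
  "(flat p has_real_derivative flat ([:0, 0, 1:] * (p - pderiv p)) t) (at t)"
proof -
  consider "t < 0" | "t = 0" | "t > 0" by linarith
  then show ?thesis
  proof cases
    case 1
    have "((\<lambda>_. 0) has_real_derivative flat ([:0, 0, 1:] * (p - pderiv p)) t) (at t)"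
      using 1 by (simp add: flat_def)
    then show ?thesis
      by (rule has_field_derivative_transform_within_open[where S = "{..<0}"])
         (use 1 in \<open>auto simp: flat_def\<close>)
  next
    case 3
    have "((\<lambda>t. poly p (1 / t) * exp (- (1 / t))) has_real_derivative
        flat ([:0, 0, 1:] * (p - pderiv p)) t) (at t)"
      using 3 by (auto intro!: derivative_eq_intros simp: flat_def field_simps power2_eq_square)
    then show ?thesis
      by (rule has_field_derivative_transform_within_open[where S = "{0<..}"])
         (use 3 in \<open>auto simp: flat_def\<close>)
  next
    case 2
    have l: "((\<lambda>h. flat p h / h) \<longlongrightarrow> 0) (at_left 0)"
      by (rule tendsto_eventually) (auto simp: eventually_at_filter flat_def)
    have "((\<lambda>h. (1 / h) * poly p (1 / h) * exp (- (1 / h))) \<longlongrightarrow> 0) (at_right (0::real))"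
    proof (rule filterlim_compose[OF poly_exp_decay])
      show "filterlim (\<lambda>h. 1 / h) at_top (at_right (0::real))" by real_asymp
    qed
    then have r: "((\<lambda>h. flat p h / h) \<longlongrightarrow> 0) (at_right 0)"
      by (rule Lim_transform_eventually) (auto simp: eventually_at_filter flat_def)
    have "((\<lambda>h. flat p h / h) \<longlongrightarrow> 0) (at 0)"
      using filterlim_split_at[OF l r] .
    then show ?thesis
      unfolding has_field_derivative_iff 2 by (simp add: flat_def[of _ 0])
  qed
qed

text \<open>The free constant c absorbs the factor \<open>i \<bullet> v\<close> that each partial
  derivative brings out, and the free p absorbs the new polynomial, so the induction closes.\<close>

lemma Ck_flat: "Ck k (\<lambda>x::'a::euclidean_space. c * flat p (x \<bullet> v + d))"
proof (induction k arbitrary: c p)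
  case 0
  have "continuous_on UNIV (flat p)"
    by (intro continuous_at_imp_continuous_on ballI DERIV_isCont[OF flat_has_derivative])
  then have "continuous_on UNIV (\<lambda>x::'a. flat p (x \<bullet> v + d))"
    by (rule continuous_on_compose2) (auto intro!: continuous_intros)
  then show ?case by (simp add: continuous_on_mult_left)
next
  case (Suc k)
  let ?q = "[:0, 0, 1:] * (p - pderiv p)"
  have der: "((\<lambda>x::'a. c * flat p (x \<bullet> v + d)) has_derivative
      (\<lambda>h. c * (flat ?q (x \<bullet> v + d) * (h \<bullet> v)))) (at x)" for x
  proof -
    have "((\<lambda>x::'a. x \<bullet> v + d) has_derivative (\<lambda>h. h \<bullet> v)) (at x)"
      by (auto intro!: derivative_eq_intros)
    from has_derivative_compose[OF this flat_has_derivative[unfolded has_field_derivative_def]]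
    show ?thesis by (intro has_derivative_mult_right)
  qed
  have eq: "frechet_derivative (\<lambda>x::'a. c * flat p (x \<bullet> v + d)) (at x) i
      = (c * (i \<bullet> v)) * flat ?q (x \<bullet> v + d)" for x i
    using frechet_derivative_at[OF der, of x, symmetric] by simp
  show ?case
    unfolding Ck.simps eq
  proof (intro conjI ballI Suc.IH)
    show "(\<lambda>x::'a. c * flat p (x \<bullet> v + d)) differentiable_on UNIV"
      using der unfolding differentiable_on_def differentiable_def by blast
  qed
qed

text \<open>A smooth approximation of the indicator of \<open>box a b\<close>. Each coordinate
  contributes one factor for the lower face and one for the upper face; r sets the sharpness, and r
  to infinity drives every factor to 1 inside the box.\<close>

definition bump :: "real \<Rightarrow> 'a::euclidean_space \<Rightarrow> 'a \<Rightarrow> 'a \<Rightarrow> real" where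
  "bump r a b x =
     (\<Prod>i\<in>Basis. flat 1 (r * ((x - a) \<bullet> i)) * flat 1 (r * ((b - x) \<bullet> i)))"

lemma flat_1_bounds: "0 \<le> flat 1 t" "flat 1 t \<le> 1"
  by (auto simp: flat_def)

lemma flat_1_eq_0_iff: "flat 1 t = 0 \<longleftrightarrow> t \<le> 0"
  by (simp add: flat_def)

lemma flat_1_limit: "(\<lambda>n. flat 1 (real n * s)) \<longlonglongrightarrow> (if 0 < s then 1 else 0)"
proof (cases "0 < s")
  case True
  have "(\<lambda>n. exp (- (1 / (real n * s)))) \<longlonglongrightarrow> 1" using True by real_asymp
  then have "(\<lambda>n. flat 1 (real n * s)) \<longlonglongrightarrow> 1"
    by (rule Lim_transform_eventually)
       (use True eventually_gt_at_top[of "0::nat"] in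
         \<open>auto elim!: eventually_mono simp: flat_def mult_le_0_iff\<close>)
  then show ?thesis using True by simp
qed (auto simp: flat_def mult_le_0_iff)

lemma bump_nonzero_iff: "0 < r \<Longrightarrow> bump r a b x \<noteq> 0 \<longleftrightarrow> x \<in> box a b"
  by (auto simp: bump_def flat_1_eq_0_iff mult_le_0_iff mem_box inner_diff_left not_le)

lemma bump_bounds: "0 \<le> bump r a b x" "bump r a b x \<le> 1"
  unfolding bump_def
  by (auto intro!: prod_nonneg prod_le_1 mult_nonneg_nonneg mult_le_one flat_1_bounds)

lemma bump_limit: "(\<lambda>n. bump (real n) a b x) \<longlonglongrightarrow> indicator (box a b) x"
proof -
  have "(\<Prod>i\<in>Basis. (if 0 < (x - a) \<bullet> i then 1 else 0) * (if 0 < (b - x) \<bullet> i then 1 else 0))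
      = (indicator (box a b) x :: real)"
    by (auto simp: indicator_def mem_box inner_diff_left)
  moreover have "(\<lambda>n. bump (real n) a b x) \<longlonglongrightarrow>
      (\<Prod>i\<in>Basis. (if 0 < (x - a) \<bullet> i then 1 else 0) * (if 0 < (b - x) \<bullet> i then 1 else 0))"
    unfolding bump_def by (intro tendsto_prod tendsto_mult flat_1_limit)
  ultimately show ?thesis by simp
qed

lemma test_function_bump:
  assumes "0 < r"
  shows "test_function (bump r a b)"
proof -
  have "Ck k (bump r a b)" for k
  proof -
    have "Ck k (\<lambda>x. flat 1 (r * ((x - a) \<bullet> i)))" "Ck k (\<lambda>x. flat 1 (r * ((b - x) \<bullet> i)))" for i
      using Ck_flat[of k 1 1 "r *\<^sub>R i" "- (r * (a \<bullet> i))"] Ck_flat[of k 1 1 "- (r *\<^sub>R i)" "r * (b \<bullet> i)"]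
      by (simp_all add: algebra_simps)
    then show ?thesis
      unfolding bump_def by (intro Ck_prod Ck_mult) auto
  qed
  moreover have "bounded {x. bump r a b x \<noteq> 0}"
    using assms by (simp add: bump_nonzero_iff)
  ultimately show ?thesis
    by (simp add: test_function_def compact_closure)
qed

lemma test_functionD:
  assumes "test_function \<phi>"
  shows "continuous_on UNIV \<phi>" "\<phi> differentiable at x"
    "i \<in> Basis \<Longrightarrow> continuous_on UNIV (\<lambda>x. frechet_derivative \<phi> (at x) i)"
    "\<exists>K. compact K \<and> (\<forall>x. x \<notin> K \<longrightarrow> \<phi> x = 0 \<and> frechet_derivative \<phi> (at x) i = 0)"
proof -
  have Ck: "Ck k \<phi>" for k using assms by (simp add: test_function_def)
  show "continuous_on UNIV \<phi>" using Ck[of 0] by simp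
  show "\<phi> differentiable at x" for x using Ck[of 1] by (simp add: differentiable_on_def)
  show "continuous_on UNIV (\<lambda>x. frechet_derivative \<phi> (at x) i)" if "i \<in> Basis"
    using Ck[of "Suc 0"] that by simp
  obtain K where K: "compact K" "{x. \<phi> x \<noteq> 0} \<subseteq> K"
    using that[OF _ closure_subset] assms[unfolded test_function_def] by iprover
  then have zero: "\<phi> y = 0" if "y \<notin> K" for y
    using that by blast
  \<comment> \<open>K is closed, so a point outside K has a neighbourhood on which
    \<open>\<phi>\<close> is constantly 0; hence one K serves the function and its
    derivative.\<close>
  have "frechet_derivative \<phi> (at x) i = 0" if "x \<notin> K" for x
  proof -
    have "open (- K)" using K by (simp add: compact_imp_closed open_Compl)
    then have "(\<phi> has_derivative (\<lambda>_. 0)) (at x)"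
      by (rule has_derivative_transform_within_open[OF has_derivative_const])
         (use that zero in auto)
    then show ?thesis
      by (simp add: frechet_derivative_at[symmetric])
  qed
  with K zero show "\<exists>K. compact K \<and> (\<forall>x. x \<notin> K \<longrightarrow> \<phi> x = 0 \<and> frechet_derivative \<phi> (at x) i = 0)"
    by blast
qed

subsection \<open>The fundamental lemma and translations\<close>

text \<open>Since \<open>ennreal\<close> sends negative numbers to 0, the two densities below are
  the positive and the negative part of f. The measures they define are finite and equal on boxes,
  which form an intersection-stable generator of the Borel sets, so they coincide; uniqueness of
  densities then forces both parts of f to agree almost everywhere.\<close>

lemma AE_zero_if_box_integrals_zero:
  fixes f :: "'a::euclidean_space \<Rightarrow> real"
  assumes [measurable]: "f \<in> borel_measurable borel"
    and int: "\<And>a b. integrable lborel (\<lambda>x. indicator (box a b) x * f x)"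
    and zero: "\<And>a b. (\<integral>x. indicator (box a b) x * f x \<partial>lborel) = 0"
  shows "AE x in lborel. f x = 0"
proof -
  let ?M = "density lborel (\<lambda>x. ennreal (f x))"
  let ?N = "density lborel (\<lambda>x. ennreal (- f x))"
  let ?E = "range (\<lambda>(a, b). box a b :: 'a set)"
  have M: "emeasure (density lborel (\<lambda>x. ennreal (g x))) (box a b)
      = (\<integral>\<^sup>+x. ennreal (indicator (box a b) x * g x) \<partial>lborel)"
    if [measurable]: "g \<in> borel_measurable borel" for g :: "'a \<Rightarrow> real" and a b
    by (subst emeasure_density) (auto intro!: nn_integral_cong split: split_indicator)
  have fin: "emeasure ?M (box a b) < \<infinity>" "emeasure ?N (box a b) < \<infinity>" for a b
    using int[of a b] by (auto simp: M real_integrable_def less_top)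
  have eq: "emeasure ?M (box a b) = emeasure ?N (box a b)" for a b
  proof -
    have "enn2real (emeasure ?M (box a b)) = enn2real (emeasure ?N (box a b))"
      using real_lebesgue_integral_def[OF int[of a b]] zero[of a b]
      by (simp add: M)
    then have "ennreal (enn2real (emeasure ?M (box a b))) = ennreal (enn2real (emeasure ?N (box a b)))"
      by simp
    then show ?thesis
      using fin[of a b] by (simp only: ennreal_enn2real infinity_ennreal_def)
  qed
  have "?M = ?N"
  proof (rule measure_eqI_generator_eq[where E = ?E and \<Omega> = UNIV
        and A = "\<lambda>n::nat. box (- (real n *\<^sub>R One)) (real n *\<^sub>R One)"])
    show "Int_stable ?E"
      by (auto simp: Int_stable_def box_Int_box)
    show "sets ?M = sigma_sets UNIV ?E" "sets ?N = sigma_sets UNIV ?E"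
      by (simp_all add: borel_eq_box)
    show "emeasure ?M (box (- (real n *\<^sub>R One)) (real n *\<^sub>R One)) \<noteq> \<infinity>" for n
      using fin by (simp add: less_top)
  qed (use eq UN_box_eq_UNIV in auto)
  then have "AE x in lborel. ennreal (f x) = ennreal (- f x)"
    by (intro sigma_finite_measure.density_unique[OF sigma_finite_lborel]) auto
  then show ?thesis
  proof eventually_elim
    case (elim x)
    then show ?case
      by (cases "0 \<le> f x") (auto simp: ennreal_neg ennreal_eq_0_iff)
  qed
qed

text \<open>Bumps are test functions, bounded by the indicator of their box and converging to it, so
  dominated convergence carries the hypothesis over to box integrals.\<close>

lemma fundamental_lemma:
  fixes f :: "'a::euclidean_space \<Rightarrow> real"
  assumes [measurable]: "f \<in> borel_measurable borel"
    and int: "\<And>a b. integrable lborel (\<lambda>x. indicator (box a b) x * f x)"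
    and zero: "\<And>\<phi>. test_function \<phi> \<Longrightarrow> (\<integral>x. \<phi> x * f x \<partial>lborel) = 0"
  shows "AE x in lborel. f x = 0"
proof (rule AE_zero_if_box_integrals_zero)
  fix a b :: 'a
  \<comment> \<open>\<open>Suc n\<close> keeps the sharpness positive, so every \<open>B n\<close>
    is a test function.\<close>
  define B where "B n = bump (real (Suc n)) a b" for n
  have [measurable]: "B n \<in> borel_measurable borel" for n
    unfolding B_def by (intro borel_measurable_continuous_onI test_functionD(1) test_function_bump) simp
  have "(\<lambda>n. \<integral>x. B n x * f x \<partial>lborel) \<longlonglongrightarrow> (\<integral>x. indicator (box a b) x * f x \<partial>lborel)"
  proof (rule integral_dominated_convergence[where w = "\<lambda>x. \<bar>indicator (box a b) x * f x\<bar>"])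
    show "integrable lborel (\<lambda>x. \<bar>indicator (box a b) x * f x\<bar>)"
      using int by (rule integrable_abs)
    show "AE x in lborel. (\<lambda>n. B n x * f x) \<longlonglongrightarrow> indicator (box a b) x * f x"
      unfolding B_def by (intro AE_I2 tendsto_mult tendsto_const LIMSEQ_Suc[OF bump_limit])
    show "AE x in lborel. norm (B n x * f x) \<le> \<bar>indicator (box a b) x * f x\<bar>" for n
    proof (rule AE_I2)
      fix x
      show "norm (B n x * f x) \<le> \<bar>indicator (box a b) x * f x\<bar>"
        using bump_bounds[of "real (Suc n)" a b x] bump_nonzero_iff[of "real (Suc n)" a b x]
        by (auto simp: B_def abs_mult mult_left_le_one_le split: split_indicator)
    qed
  qed auto
  moreover have "(\<integral>x. B n x * f x \<partial>lborel) = 0" for n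
    unfolding B_def by (intro zero test_function_bump) simp
  ultimately show "(\<integral>x. indicator (box a b) x * f x \<partial>lborel) = 0"
    by (simp add: LIMSEQ_const_iff)
qed (use assms in auto)

section \<open>Continuity of translations in L^1\<close>

lemma integrable_translate_iff:
  fixes f :: "'a::euclidean_space \<Rightarrow> 'b::{banach, second_countable_topology}"
  shows "integrable lborel (\<lambda>x. f (x + c)) \<longleftrightarrow> integrable lborel f"
proof -
  have "integrable lborel (\<lambda>x. g (c + x))" if "integrable lborel g" for g :: "'a \<Rightarrow> 'b" and c
    using that by (subst (asm) lborel_distr_plus[of c, symmetric]) (rule integrable_distr[rotated], auto)
  from this[of f c] this[of "\<lambda>x. f (c + x)" "- c"] show ?thesis
    by (auto simp: add.commute)
qed

lemma integral_translate:
  fixes f :: "'a::euclidean_space \<Rightarrow> 'b::{banach, second_countable_topology}"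
  shows "(\<integral>x. f (x + c) \<partial>lborel) = (\<integral>x. f x \<partial>lborel)"
proof (cases "integrable lborel f")
  case True
  then have [measurable]: "f \<in> borel_measurable borel" by simp
  show ?thesis
    by (subst (2) lborel_distr_plus[of c, symmetric]) (simp add: integral_distr add.commute)
next
  case False
  then show ?thesis
    by (simp add: integrable_translate_iff not_integrable_integral_eq)
qed

text \<open>The e/3 argument, isolated because it is used twice: for sets approximated by open sets
  and for limits of functions. A translate of f - g has the same integral of the norm as f - g, so
  the first and the last error are equal.\<close>

lemma translation_continuous_L1_approx:
  fixes f :: "'a::euclidean_space \<Rightarrow> 'b::{banach, second_countable_topology}"
  assumes f: "integrable lborel f"
    and approx: "\<And>e. 0 < e \<Longrightarrow> \<exists>g. integrable lborel g \<and> (\<integral>x. norm (f x - g x) \<partial>lborel) < e \<and>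
      (\<lambda>n. \<integral>x. norm (g (x + Z n) - g x) \<partial>lborel) \<longlonglongrightarrow> 0"
  shows "(\<lambda>n. \<integral>x. norm (f (x + Z n) - f x) \<partial>lborel) \<longlonglongrightarrow> (0::real)"
proof (rule LIMSEQ_I)
  fix e :: real assume "0 < e"
  then obtain g where g: "integrable lborel g" "(\<integral>x. norm (f x - g x) \<partial>lborel) < e / 3"
    and lim: "(\<lambda>n. \<integral>x. norm (g (x + Z n) - g x) \<partial>lborel) \<longlonglongrightarrow> 0"
    using approx[of "e / 3"] by auto
  obtain N where N: "\<bar>\<integral>x. norm (g (x + Z n) - g x) \<partial>lborel\<bar> < e / 3" if "n \<ge> N" for n
    using LIMSEQ_D[OF lim, of "e / 3"] \<open>0 < e\<close> by auto
  have "norm ((\<integral>x. norm (f (x + Z n) - f x) \<partial>lborel) - 0) < e" if "n \<ge> N" for n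
  proof -
    have i: "integrable lborel (\<lambda>x. f (x + Z n))" "integrable lborel (\<lambda>x. g (x + Z n))"
      using f g by (simp_all add: integrable_translate_iff)
    have "(\<integral>x. norm (f (x + Z n) - f x) \<partial>lborel)
        \<le> (\<integral>x. norm (f (x + Z n) - g (x + Z n)) + norm (g (x + Z n) - g x) + norm (f x - g x) \<partial>lborel)"
    proof (rule integral_mono)
      show "norm (f (x + Z n) - f x)
          \<le> norm (f (x + Z n) - g (x + Z n)) + norm (g (x + Z n) - g x) + norm (f x - g x)" for x
        by norm
    qed (use f g i in auto)
    also have "\<dots> = (\<integral>x. norm (f (x + Z n) - g (x + Z n)) \<partial>lborel)
        + (\<integral>x. norm (g (x + Z n) - g x) \<partial>lborel) + (\<integral>x. norm (f x - g x) \<partial>lborel)"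
      using f g i by simp
    also have "(\<integral>x. norm (f (x + Z n) - g (x + Z n)) \<partial>lborel) = (\<integral>x. norm (f x - g x) \<partial>lborel)"
      by (rule integral_translate)
    finally show ?thesis
      using N[OF that] g(2) by simp
  qed
  then show "\<exists>N. \<forall>n\<ge>N. norm ((\<integral>x. norm (f (x + Z n) - f x) \<partial>lborel) - 0) < e" by blast
qed

text \<open>
  The indicator of an open set is lower semicontinuous, so dominated convergence controls the
  positive part of the difference; the negative part has the same integral.
\<close>

lemma translation_continuous_L1_open:
  fixes U :: "'a::euclidean_space set"
  assumes "open U" "emeasure lborel U < \<infinity>" and Z: "Z \<longlonglongrightarrow> 0"
  shows "(\<lambda>n. \<integral>x. \<bar>indicator U (x + Z n) - indicator U x\<bar> \<partial>lborel) \<longlonglongrightarrow> (0::real)"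
proof -
  have [measurable]: "U \<in> sets borel" using \<open>open U\<close> by simp
  have i: "integrable lborel (indicator U :: 'a \<Rightarrow> real)"
    using assms by (simp add: integrable_indicator_iff)
  have iZ: "integrable lborel (\<lambda>x. indicator U (x + Z n) :: real)" for n
    using i by (simp add: integrable_translate_iff)
  have "(\<lambda>n. \<integral>x. indicator U x * (1 - indicator U (x + Z n)) \<partial>lborel) \<longlonglongrightarrow> (\<integral>x. (0::real) \<partial>(lborel::'a measure))"
  proof (rule integral_dominated_convergence[where w = "indicator U"])
    show "AE x in lborel. (\<lambda>n. indicator U x * (1 - indicator U (x + Z n))) \<longlonglongrightarrow> (0::real)"
    proof (rule AE_I2)
      fix x
      show "(\<lambda>n. indicator U x * (1 - indicator U (x + Z n))) \<longlonglongrightarrow> (0::real)"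
      proof (cases "x \<in> U")
        case True
        have "(\<lambda>n. x + Z n) \<longlonglongrightarrow> x" using tendsto_add[OF tendsto_const Z, of x] by simp
        then have "\<forall>\<^sub>F n in sequentially. x + Z n \<in> U"
          using \<open>open U\<close> True by (rule topological_tendstoD)
        then show ?thesis
          by (intro tendsto_eventually) (auto elim!: eventually_mono split: split_indicator)
      qed simp
    qed
  qed (use i in \<open>auto split: split_indicator\<close>)
  then have lim: "(\<lambda>n. 2 * (\<integral>x. indicator U x * (1 - indicator U (x + Z n)) \<partial>lborel)) \<longlonglongrightarrow> (0::real)"
    by (intro tendsto_mult_right_zero) simp
  have "(\<integral>x. \<bar>indicator U (x + Z n) - indicator U x\<bar> \<partial>lborel)
      = (2::real) * (\<integral>x. indicator U x * (1 - indicator U (x + Z n)) \<partial>lborel)" (is "?l = _") for n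
  proof -
    have p: "integrable lborel (\<lambda>x. indicator U x * (1 - indicator U (x + Z n)) :: real)"
      by (rule Bochner_Integration.integrable_bound[OF i]) (auto split: split_indicator)
    have "?l = (\<integral>x. 2 * (indicator U x * (1 - indicator U (x + Z n)))
        + (indicator U (x + Z n) - indicator U x) \<partial>lborel)"
      by (intro Bochner_Integration.integral_cong) (auto split: split_indicator)
    also have "\<dots> = 2 * (\<integral>x. indicator U x * (1 - indicator U (x + Z n)) \<partial>lborel)
        + ((\<integral>x. indicator U (x + Z n) \<partial>lborel) - (\<integral>x. indicator U x \<partial>lborel))"
      using p i iZ by simp
    also have "(\<integral>x. indicator U (x + Z n) \<partial>lborel) = (\<integral>x. (indicator U x :: real) \<partial>lborel)"
      by (rule integral_translate)
    finally show ?thesis by simp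
  qed
  with lim show ?thesis by simp
qed

text \<open>Induction over integrable functions. For an indicator, outer regularity supplies an open
  superset of nearly the same measure; sums follow from the triangle inequality, and dominated
  limits from the approximation lemma.\<close>

lemma translation_continuous_L1:
  fixes f :: "'a::euclidean_space \<Rightarrow> 'b::{banach, second_countable_topology}"
  assumes "integrable lborel f" and Z: "Z \<longlonglongrightarrow> 0"
  shows "(\<lambda>n. \<integral>x. norm (f (x + Z n) - f x) \<partial>lborel) \<longlonglongrightarrow> (0::real)"
  using assms(1)
proof (induction rule: integrable_induct)
  case (base A c)
  have [measurable]: "A \<in> sets borel" using base by simp
  have iA: "integrable lborel (indicator A :: 'a \<Rightarrow> real)"
    using base by (simp add: integrable_indicator_iff)
  have "(\<lambda>n. \<integral>x. norm (indicator A (x + Z n) - indicator A x :: real) \<partial>lborel) \<longlonglongrightarrow> 0"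
  proof (rule translation_continuous_L1_approx[OF iA])
    fix e :: real assume "0 < e"
    then obtain U where U: "open U" "A \<subseteq> U" "emeasure lborel (U - A) < e"
      using outer_regular_lborel[of A e] by auto
    have [measurable]: "U \<in> sets borel" using U by simp
    have "emeasure lborel U \<le> emeasure lborel A + emeasure lborel (U - A)"
      using emeasure_subadditive[of A lborel "U - A"] U(2) by (simp add: Un_absorb1)
    also have "\<dots> < \<infinity>"
      using base U(3) by (simp add: order.strict_trans[OF U(3)])
    finally have fin: "emeasure lborel U < \<infinity>" .
    have "(\<integral>x. norm (indicator A x - indicator U x :: real) \<partial>lborel) = (\<integral>x. indicator (U - A) x \<partial>lborel)"
      using U(2) by (intro Bochner_Integration.integral_cong) (auto split: split_indicator)
    also have "\<dots> = measure lborel (U - A)" by simp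
    also have "\<dots> < e"
      using U(3) \<open>0 < e\<close> by (simp add: measure_def enn2real_less_iff order.strict_trans[OF U(3)])
    finally show "\<exists>g. integrable lborel g \<and> (\<integral>x. norm (indicator A x - g x :: real) \<partial>lborel) < e \<and>
      (\<lambda>n. \<integral>x. norm (g (x + Z n) - g x) \<partial>lborel) \<longlonglongrightarrow> 0"
      using fin translation_continuous_L1_open[OF U(1) fin Z]
      by (intro exI[of _ "indicator U"]) (simp add: integrable_indicator_iff)
  qed
  then have "(\<lambda>n. (\<integral>x. \<bar>indicator A (x + Z n) - indicator A x\<bar> \<partial>lborel) * norm c) \<longlonglongrightarrow> (0::real)"
    by (intro tendsto_mult_left_zero) simp
  then show ?case
    by (simp add: scaleR_diff_left[symmetric])
next
  case (add f g)
  show ?case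
  proof (rule tendsto_sandwich[OF _ _ tendsto_const])
    have i: "integrable lborel (\<lambda>x. f (x + Z n))" "integrable lborel (\<lambda>x. g (x + Z n))" for n
      using add by (simp_all add: integrable_translate_iff)
    have "(\<integral>x. norm (f (x + Z n) + g (x + Z n) - (f x + g x)) \<partial>lborel)
        \<le> (\<integral>x. norm (f (x + Z n) - f x) + norm (g (x + Z n) - g x) \<partial>lborel)" for n
      using add i by (intro integral_mono norm_diff_triangle_ineq) auto
    then show "\<forall>\<^sub>F n in sequentially. (\<integral>x. norm (f (x + Z n) + g (x + Z n) - (f x + g x)) \<partial>lborel)
        \<le> (\<integral>x. norm (f (x + Z n) - f x) \<partial>lborel) + (\<integral>x. norm (g (x + Z n) - g x) \<partial>lborel)"
      using add i by (intro always_eventually) simp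
    show "(\<lambda>n. (\<integral>x. norm (f (x + Z n) - f x) \<partial>lborel) + (\<integral>x. norm (g (x + Z n) - g x) \<partial>lborel)) \<longlonglongrightarrow> 0"
      using tendsto_add[OF add.IH] by simp
  qed simp
next
  case (lim f s)
  have [measurable]: "f \<in> borel_measurable borel" "s i \<in> borel_measurable borel" for i
    using borel_measurable_integrable[OF lim.hyps(4)] borel_measurable_integrable[OF lim.hyps(1)[of i]]
    by auto
  show ?case
  proof (rule translation_continuous_L1_approx[OF lim.hyps(4)])
    fix e :: real assume "0 < e"
    \<comment> \<open>The induction rule provides approximants with
      \<open>norm (s i x) \<le> 2 * norm (f x)\<close>, hence the dominating function with factor
      3.\<close>
    have "(\<lambda>i. \<integral>x. norm (f x - s i x) \<partial>lborel) \<longlonglongrightarrow> (\<integral>x. 0 \<partial>(lborel :: 'a measure))"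
    proof (rule integral_dominated_convergence[where w = "\<lambda>x. 3 * norm (f x)"])
      show "integrable lborel (\<lambda>x. 3 * norm (f x))"
        using lim.hyps(4) by (intro integrable_mult_right integrable_norm)
      show "AE x in lborel. norm (norm (f x - s i x)) \<le> 3 * norm (f x)" for i
      proof (rule AE_I2)
        fix x
        show "norm (norm (f x - s i x)) \<le> 3 * norm (f x)"
          using norm_triangle_ineq4[of "f x" "s i x"] lim.hyps(3)[of x i] by simp
      qed
      show "AE x in lborel. (\<lambda>i. norm (f x - s i x)) \<longlonglongrightarrow> 0"
      proof (rule AE_I2)
        fix x
        have "(\<lambda>i. f x - s i x) \<longlonglongrightarrow> f x - f x"
          by (intro tendsto_diff tendsto_const lim.hyps(2)) simp
        then show "(\<lambda>i. norm (f x - s i x)) \<longlonglongrightarrow> 0"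
          unfolding diff_self by (rule tendsto_norm_zero)
      qed
    qed auto
    then have "\<forall>\<^sub>F i in sequentially. (\<integral>x. norm (f x - s i x) \<partial>lborel) < e"
      using \<open>0 < e\<close> by (intro order_tendstoD(2)) simp_all
    then obtain i where "(\<integral>x. norm (f x - s i x) \<partial>lborel) < e"
      using eventually_happens'[OF sequentially_bot] by blast
    then show "\<exists>g. integrable lborel g \<and> (\<integral>x. norm (f x - g x) \<partial>lborel) < e \<and>
      (\<lambda>n. \<integral>x. norm (g (x + Z n) - g x) \<partial>lborel) \<longlonglongrightarrow> 0"
      using lim.hyps(1)[of i] lim.IH[of i] by (intro exI[of _ "s i"] conjI)
  qed
qed

section \<open>Square-integrable functions and continuity of translations in L^2\<close>

lemma L2_funD:
  assumes "L2_fun u"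
  shows "u \<in> borel_measurable borel" "integrable lborel (\<lambda>x. (norm (u x))\<^sup>2)"
  using assms by (simp_all add: L2_fun_def)

lemma L2_funI:
  assumes "u \<in> borel_measurable borel" "integrable lborel g" "\<And>x. (norm (u x))\<^sup>2 \<le> g x"
  shows "L2_fun u"
proof -
  have [measurable]: "u \<in> borel_measurable borel" by fact
  have "integrable lborel (\<lambda>x. (norm (u x))\<^sup>2)"
  proof (rule Bochner_Integration.integrable_bound[OF assms(2)])
    show "AE x in lborel. norm ((norm (u x))\<^sup>2) \<le> norm (g x)"
      using assms(3) by (intro AE_I2) (simp add: order.trans[OF _ abs_ge_self])
  qed simp
  then show ?thesis by (simp add: L2_fun_def)
qed

lemma norm_add_sq_le:
  fixes a b :: "'b::real_normed_vector"
  shows "(norm (a + b))\<^sup>2 \<le> 2 * (norm a)\<^sup>2 + 2 * (norm b)\<^sup>2"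
proof -
  have "(norm (a + b))\<^sup>2 \<le> (norm a + norm b)\<^sup>2"
    by (intro power_mono norm_triangle_ineq) simp
  then show ?thesis
    using sum_squares_bound[of "norm a" "norm b"] by (simp add: power2_sum)
qed

lemma L2_fun_add:
  assumes "L2_fun u" "L2_fun w"
  shows "L2_fun (\<lambda>x. u x + w x)"
proof (rule L2_funI)
  show "integrable lborel (\<lambda>x. 2 * (norm (u x))\<^sup>2 + 2 * (norm (w x))\<^sup>2)"
    using assms[THEN L2_funD(2)] by simp
qed (use assms[THEN L2_funD(1)] norm_add_sq_le in auto)

lemma L2_fun_scaleR:
  assumes "L2_fun u"
  shows "L2_fun (\<lambda>x. c *\<^sub>R u x)"
  using assms by (auto simp: L2_fun_def power_mult_distrib)

lemma L2_fun_diff: "L2_fun u \<Longrightarrow> L2_fun w \<Longrightarrow> L2_fun (\<lambda>x. u x - w x)"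
  using L2_fun_add[of u "\<lambda>x. (- 1) *\<^sub>R w x"] L2_fun_scaleR[of w "- 1"] by simp

lemma L2_fun_sum:
  assumes "finite I" "\<And>i. i \<in> I \<Longrightarrow> L2_fun (f i)"
  shows "L2_fun (\<lambda>x. \<Sum>i\<in>I. f i x)"
  using assms
proof (induction I rule: finite_induct)
  case empty
  show ?case by (simp add: L2_fun_def)
qed (auto intro: L2_fun_add)

lemma L2_fun_translate:
  assumes "L2_fun u"
  shows "L2_fun (\<lambda>x. u (x + z))"
  using assms integrable_translate_iff[of "\<lambda>x. (norm (u x))\<^sup>2" z] by (auto simp: L2_fun_def)

lemma integrable_inner_L2:
  assumes "L2_fun u" "L2_fun w"
  shows "integrable lborel (\<lambda>x. u x \<bullet> w x)"
proof (rule Bochner_Integration.integrable_bound)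
  note [measurable] = assms[THEN L2_funD(1)]
  show "integrable lborel (\<lambda>x. (norm (u x))\<^sup>2 + (norm (w x))\<^sup>2)"
    using assms[THEN L2_funD(2)] by simp
  show "(\<lambda>x. u x \<bullet> w x) \<in> borel_measurable lborel" by simp
  have "\<bar>u x \<bullet> w x\<bar> \<le> (norm (u x))\<^sup>2 + (norm (w x))\<^sup>2" for x
    using Cauchy_Schwarz_ineq2[of "u x" "w x"] sum_squares_bound[of "norm (u x)" "norm (w x)"]
      zero_le_power2[of "norm (u x)"] zero_le_power2[of "norm (w x)"] by linarith
  then show "AE x in lborel. norm (u x \<bullet> w x) \<le> norm ((norm (u x))\<^sup>2 + (norm (w x))\<^sup>2)"
    by (intro AE_I2) simp
qed

lemma integrable_scaleR_L2:
  fixes k :: "'a::euclidean_space \<Rightarrow> real"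
  assumes [measurable]: "k \<in> borel_measurable borel" and k2: "integrable lborel (\<lambda>x. (k x)\<^sup>2)"
    and "L2_fun u"
  shows "integrable lborel (\<lambda>x. k x *\<^sub>R u x)"
proof (rule Bochner_Integration.integrable_bound)
  note [measurable] = L2_funD(1)[OF assms(3)]
  show "integrable lborel (\<lambda>x. (k x)\<^sup>2 + (norm (u x))\<^sup>2)"
    using k2 L2_funD(2)[OF assms(3)] by simp
  show "(\<lambda>x. k x *\<^sub>R u x) \<in> borel_measurable lborel" by simp
  have "norm (k x *\<^sub>R u x) \<le> (k x)\<^sup>2 + (norm (u x))\<^sup>2" for x
    using sum_squares_bound[of "\<bar>k x\<bar>" "norm (u x)"]
      zero_le_power2[of "k x"] zero_le_power2[of "norm (u x)"]
    by (simp add: mult.assoc) (smt (verit) abs_ge_zero mult_nonneg_nonneg norm_ge_zero)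
  then show "AE x in lborel. norm (k x *\<^sub>R u x) \<le> norm ((k x)\<^sup>2 + (norm (u x))\<^sup>2)"
    by (intro AE_I2) simp
qed

text \<open>Young's inequality with a free weight, in the role of Cauchy-Schwarz: a small
  \<open>\<delta>\<close> controls the factor that stays fixed, and the factor
  1/\<open>\<delta>\<close> is absorbed by the one that tends to 0.\<close>

lemma abs_integral_inner_L2_le:
  assumes "L2_fun u" "L2_fun w" "0 < \<delta>"
  shows "\<bar>\<integral>x. u x \<bullet> w x \<partial>lborel\<bar>
    \<le> \<delta> * (\<integral>x. (norm (u x))\<^sup>2 \<partial>lborel) + (\<integral>x. (norm (w x))\<^sup>2 \<partial>lborel) / \<delta>"
proof -
  have le: "\<bar>u x \<bullet> w x\<bar> \<le> \<delta> * (norm (u x))\<^sup>2 + (norm (w x))\<^sup>2 / \<delta>" for x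
  proof -
    have "2 * (\<delta> * norm (u x)) * norm (w x) \<le> (\<delta> * norm (u x))\<^sup>2 + (norm (w x))\<^sup>2"
      by (rule sum_squares_bound)
    then have "2 * (norm (u x) * norm (w x)) \<le> \<delta> * (norm (u x))\<^sup>2 + (norm (w x))\<^sup>2 / \<delta>"
      using \<open>0 < \<delta>\<close> by (simp add: field_simps power2_eq_square)
    moreover have "\<bar>u x \<bullet> w x\<bar> \<le> norm (u x) * norm (w x)" "0 \<le> norm (u x) * norm (w x)"
      by (simp_all add: Cauchy_Schwarz_ineq2)
    ultimately show ?thesis by linarith
  qed
  have i: "integrable lborel (\<lambda>x. \<delta> * (norm (u x))\<^sup>2)" "integrable lborel (\<lambda>x. (norm (w x))\<^sup>2 / \<delta>)"
    using assms(1,2)[THEN L2_funD(2)] by simp_all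
  have "\<bar>\<integral>x. u x \<bullet> w x \<partial>lborel\<bar> \<le> (\<integral>x. \<bar>u x \<bullet> w x\<bar> \<partial>lborel)"
    by (rule integral_abs_bound)
  also have "\<dots> \<le> (\<integral>x. \<delta> * (norm (u x))\<^sup>2 + (norm (w x))\<^sup>2 / \<delta> \<partial>lborel)"
    using le i integrable_inner_L2[OF assms(1,2)] by (intro integral_mono) auto
  also have "\<dots> = \<delta> * (\<integral>x. (norm (u x))\<^sup>2 \<partial>lborel) + (\<integral>x. (norm (w x))\<^sup>2 \<partial>lborel) / \<delta>"
    using i by simp
  finally show ?thesis .
qed

lemma tendsto_inner_L2:
  assumes "L2_fun h" and d: "\<And>n. L2_fun (d n)"
    and lim: "(\<lambda>n. \<integral>x. (norm (d n x))\<^sup>2 \<partial>lborel) \<longlonglongrightarrow> 0"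
  shows "(\<lambda>n. \<integral>x. h x \<bullet> d n x \<partial>lborel) \<longlonglongrightarrow> 0"
proof (rule LIMSEQ_I)
  fix e :: real assume "0 < e"
  let ?H = "\<integral>x. (norm (h x))\<^sup>2 \<partial>lborel"
  \<comment> \<open>The summand 1 keeps K positive even for h = 0. Then
    \<open>\<delta> = e / (2 * K)\<close> puts the contribution of h below e/2.\<close>
  define K where "K = ?H + 1"
  have K: "0 < K" "?H < K" by (simp_all add: K_def add_nonneg_pos)
  define \<delta> where "\<delta> = e / (2 * K)"
  have \<delta>: "0 < \<delta>" "\<delta> * K = e / 2" using \<open>0 < e\<close> K(1) by (simp_all add: \<delta>_def)
  have \<delta>H: "\<delta> * ?H < e / 2"
    using mult_strict_left_mono[OF K(2) \<delta>(1)] \<delta>(2) by simp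
  have "0 < \<delta> * (e / 2)" using \<delta>(1) \<open>0 < e\<close> by simp
  then obtain N where N: "\<bar>\<integral>x. (norm (d n x))\<^sup>2 \<partial>lborel\<bar> < \<delta> * (e / 2)" if "n \<ge> N" for n
    using LIMSEQ_D[OF lim] by fastforce
  have "norm ((\<integral>x. h x \<bullet> d n x \<partial>lborel) - 0) < e" if "n \<ge> N" for n
  proof -
    have "(\<integral>x. (norm (d n x))\<^sup>2 \<partial>lborel) / \<delta> < e / 2"
      using N[OF that] \<delta>(1) by (simp add: field_simps)
    then show ?thesis
      using abs_integral_inner_L2_le[OF assms(1) d \<delta>(1), of n] \<delta>H
      unfolding real_norm_def diff_zero by linarith
  qed
  then show "\<exists>N. \<forall>n\<ge>N. norm ((\<integral>x. h x \<bullet> d n x \<partial>lborel) - 0) < e" by blast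
qed

text \<open>Cut u down to the set where its modulus lies between 1/(n+1) and n+1. The lower
  threshold gives |u| \<le> (n+1) |u|^2 there, hence integrability; the upper one gives boundedness.
  At each point the truncation eventually equals u.\<close>

lemma L2_truncation:
  assumes u: "L2_fun u" and "0 < e"
  obtains a C where "integrable lborel a" "L2_fun a" "0 \<le> C" "\<And>x. norm (a x) \<le> C"
    "(\<integral>x. (norm (u x - a x))\<^sup>2 \<partial>lborel) < e"
proof -
  note [measurable] = L2_funD(1)[OF u]
  define P where "P n x \<longleftrightarrow> 1 / (real n + 1) \<le> norm (u x) \<and> norm (u x) \<le> real n + 1" for n :: nat and x
  define a where "a n x = (if P n x then u x else 0)" for n x
  have [measurable]: "a n \<in> borel_measurable borel" for n
    unfolding a_def P_def by measurable
  have bound: "norm (a n x) \<le> (real n + 1) * (norm (u x))\<^sup>2" for n x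
  proof (cases "P n x")
    case True
    then have "1 \<le> (real n + 1) * norm (u x)"
      by (simp add: P_def field_simps)
    from mult_right_mono[OF this norm_ge_zero[of "u x"]] True show ?thesis
      by (simp add: a_def power2_eq_square)
  qed (simp add: a_def)
  have "integrable lborel (a n)" for n
  proof (rule Bochner_Integration.integrable_bound)
    show "integrable lborel (\<lambda>x. (real n + 1) * (norm (u x))\<^sup>2)"
      using L2_funD(2)[OF u] by (rule integrable_mult_right)
    show "AE x in lborel. norm (a n x) \<le> norm ((real n + 1) * (norm (u x))\<^sup>2)"
      unfolding real_norm_def by (intro AE_I2 order.trans[OF bound abs_ge_self])
  qed simp
  moreover have "L2_fun (a n)" for n
    by (rule L2_funI[OF _ L2_funD(2)[OF u]]) (auto simp: a_def)
  moreover have "norm (a n x) \<le> real n + 1" for n x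
    by (auto simp: a_def P_def)
  moreover have "(\<lambda>n. \<integral>x. (norm (u x - a n x))\<^sup>2 \<partial>lborel) \<longlonglongrightarrow> (\<integral>x. 0 \<partial>(lborel::'a measure))"
  proof (rule integral_dominated_convergence[OF _ _ L2_funD(2)[OF u]])
    show "AE x in lborel. (\<lambda>n. (norm (u x - a n x))\<^sup>2) \<longlonglongrightarrow> 0"
    proof (intro AE_I2 tendsto_eventually)
      fix x
      show "\<forall>\<^sub>F n in sequentially. (norm (u x - a n x))\<^sup>2 = 0"
      proof (cases "u x = 0")
        case False
        then have pos: "0 < norm (u x)" by simp
        have "((\<lambda>n. 1 / (real n + 1)) \<longlonglongrightarrow> 0)" by real_asymp
        moreover have "filterlim (\<lambda>n. real n + 1) at_top sequentially" by real_asymp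
        ultimately have "\<forall>\<^sub>F n in sequentially. 1 / (real n + 1) < norm (u x)"
            "\<forall>\<^sub>F n in sequentially. norm (u x) \<le> real n + 1"
          using pos by (auto simp: filterlim_at_top intro: order_tendstoD(2))
        then have "\<forall>\<^sub>F n in sequentially. P n x"
          unfolding P_def by eventually_elim simp
        then show ?thesis by eventually_elim (simp add: a_def)
      qed (simp add: a_def)
    qed
    show "AE x in lborel. norm ((norm (u x - a n x))\<^sup>2) \<le> (norm (u x))\<^sup>2" for n
      by (auto simp: a_def)
  qed auto
  then have "\<forall>\<^sub>F n in sequentially. (\<integral>x. (norm (u x - a n x))\<^sup>2 \<partial>lborel) < e"
    using \<open>0 < e\<close> by (intro order_tendstoD(2)) simp_all
  then obtain n where "(\<integral>x. (norm (u x - a n x))\<^sup>2 \<partial>lborel) < e"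
    using eventually_happens'[OF sequentially_bot] by blast
  ultimately show ?thesis
    using that[of "a n" "real n + 1"] by simp
qed

text \<open>Reduction to L^1: on the bounded integrable part a, the squared increment is at most 2C
  times the increment itself, while the remainder b = u - a is small in L^2 together with all its
  translates.\<close>

lemma translation_continuous_L2:
  assumes u: "L2_fun u" and Z: "Z \<longlonglongrightarrow> 0"
  shows "(\<lambda>n. \<integral>x. (norm (u (x + Z n) - u x))\<^sup>2 \<partial>lborel) \<longlonglongrightarrow> 0"
proof (rule LIMSEQ_I)
  fix e :: real assume "0 < e"
  \<comment> \<open>The remainder enters below twice with factor 4, once translated and once not,
    which costs 8 * e/16 = e/2.\<close>
  then have "0 < e / 16" by simp
  from L2_truncation[OF u this] obtain a C where a: "integrable lborel a" "L2_fun a" "0 \<le> C"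
      "\<And>x. norm (a x) \<le> C" "(\<integral>x. (norm (u x - a x))\<^sup>2 \<partial>lborel) < e / 16"
    by blast
  define b where "b x = u x - a x" for x
  have b: "L2_fun b" unfolding b_def using u a(2) by (rule L2_fun_diff)
  have "(\<lambda>n. 4 * C * (\<integral>x. norm (a (x + Z n) - a x) \<partial>lborel)) \<longlonglongrightarrow> 0"
    by (intro tendsto_mult_right_zero translation_continuous_L1 a(1) Z)
  from LIMSEQ_D[OF this, of "e / 2"] \<open>0 < e\<close>
  obtain N where N: "4 * C * (\<integral>x. norm (a (x + Z n) - a x) \<partial>lborel) < e / 2" if "n \<ge> N" for n
    by fastforce
  have "norm ((\<integral>x. (norm (u (x + Z n) - u x))\<^sup>2 \<partial>lborel) - 0) < e" if "n \<ge> N" for n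
  proof -
    let ?da = "\<lambda>x. a (x + Z n) - a x" and ?Tb = "\<lambda>x. b (x + Z n)"
    have le: "(norm (u (x + Z n) - u x))\<^sup>2 \<le>
        4 * C * norm (?da x) + 4 * (norm (?Tb x))\<^sup>2 + 4 * (norm (b x))\<^sup>2" for x
    proof -
      have "u (x + Z n) - u x = ?da x + (?Tb x - b x)"
        by (simp add: b_def)
      then have "(norm (u (x + Z n) - u x))\<^sup>2 \<le> 2 * (norm (?da x))\<^sup>2 + 2 * (norm (?Tb x - b x))\<^sup>2"
        by (metis norm_add_sq_le)
      moreover have "(norm (?Tb x - b x))\<^sup>2 \<le> 2 * (norm (?Tb x))\<^sup>2 + 2 * (norm (b x))\<^sup>2"
        using norm_add_sq_le[of "?Tb x" "- b x"] by simp
      moreover have "(norm (?da x))\<^sup>2 \<le> 2 * C * norm (?da x)"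
      proof -
        have "norm (?da x) \<le> 2 * C"
          using norm_triangle_ineq4[of "a (x + Z n)" "a x"] a(4)[of x] a(4)[of "x + Z n"] by linarith
        then show ?thesis by (simp add: power2_eq_square mult_right_mono)
      qed
      ultimately show ?thesis by linarith
    qed
    have i: "integrable lborel (\<lambda>x. norm (?da x))" "integrable lborel (\<lambda>x. (norm (?Tb x))\<^sup>2)"
        "integrable lborel (\<lambda>x. (norm (b x))\<^sup>2)" "integrable lborel (\<lambda>x. (norm (u (x + Z n) - u x))\<^sup>2)"
      using a(1) L2_funD(2)[OF b] L2_funD(2)[OF L2_fun_translate[OF b]]
        L2_funD(2)[OF L2_fun_diff[OF L2_fun_translate[OF u] u]]
      by (auto simp: integrable_translate_iff intro!: integrable_norm Bochner_Integration.integrable_diff)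
    have "(\<integral>x. (norm (u (x + Z n) - u x))\<^sup>2 \<partial>lborel)
        \<le> (\<integral>x. 4 * C * norm (?da x) + 4 * (norm (?Tb x))\<^sup>2 + 4 * (norm (b x))\<^sup>2 \<partial>lborel)"
      using i le by (intro integral_mono) auto
    also have "\<dots> = 4 * C * (\<integral>x. norm (?da x) \<partial>lborel)
        + 4 * (\<integral>x. (norm (?Tb x))\<^sup>2 \<partial>lborel) + 4 * (\<integral>x. (norm (b x))\<^sup>2 \<partial>lborel)"
      using i by simp
    also have "(\<integral>x. (norm (?Tb x))\<^sup>2 \<partial>lborel) = (\<integral>x. (norm (b x))\<^sup>2 \<partial>lborel)"
      by (rule integral_translate)
    finally show ?thesis
      using N[OF that] a(5) unfolding b_def by simp
  qed
  then show "\<exists>N. \<forall>n\<ge>N. norm ((\<integral>x. (norm (u (x + Z n) - u x))\<^sup>2 \<partial>lborel) - 0) < e" by blast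
qed

lemma correlation_isCont_0:
  assumes p: "L2_fun p" and q: "L2_fun q"
  shows "isCont (\<lambda>z. \<integral>x. p (x + z) \<bullet> q x \<partial>lborel) 0"
  unfolding continuous_at_sequentially comp_def
proof (intro allI impI)
  fix Z :: "nat \<Rightarrow> 'a" assume Z: "Z \<longlonglongrightarrow> 0"
  have d: "L2_fun (\<lambda>x. p (x + Z n) - p x)" for n
    using L2_fun_diff[OF L2_fun_translate[OF p] p] .
  have "(\<lambda>n. (\<integral>x. q x \<bullet> (p (x + Z n) - p x) \<partial>lborel) + (\<integral>x. p x \<bullet> q x \<partial>lborel))
      \<longlonglongrightarrow> 0 + (\<integral>x. p x \<bullet> q x \<partial>lborel)"
    by (intro tendsto_add tendsto_const tendsto_inner_L2 translation_continuous_L2 p q d Z)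
  moreover have "(\<integral>x. q x \<bullet> (p (x + Z n) - p x) \<partial>lborel) + (\<integral>x. p x \<bullet> q x \<partial>lborel)
      = (\<integral>x. p (x + Z n) \<bullet> q x \<partial>lborel)" for n
    using integrable_inner_L2[OF q d[of n]] integrable_inner_L2[OF p q]
    by (subst Bochner_Integration.integral_add[symmetric])
       (auto simp: inner_diff_right inner_commute intro!: Bochner_Integration.integral_cong)
  ultimately show "(\<lambda>n. \<integral>x. p (x + Z n) \<bullet> q x \<partial>lborel) \<longlonglongrightarrow> (\<integral>x. p (x + 0) \<bullet> q x \<partial>lborel)"
    by simp
qed

subsection \<open>Integration by parts for weak derivatives\<close>

text \<open>A common class for test functions and their partial derivatives, both of which serve as
  integral kernels below.\<close>

definition Cc :: "('a::euclidean_space \<Rightarrow> real) \<Rightarrow> bool" where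
  "Cc k \<longleftrightarrow> continuous_on UNIV k \<and> (\<exists>K. compact K \<and> (\<forall>x. x \<notin> K \<longrightarrow> k x = 0))"

lemma Cc_borel: "Cc k \<Longrightarrow> k \<in> borel_measurable borel"
  by (auto simp: Cc_def intro: borel_measurable_continuous_onI)

lemma Cc_integrable:
  assumes "Cc k"
  shows "integrable lborel k"
proof -
  obtain K where K: "compact K" "\<And>x. x \<notin> K \<Longrightarrow> k x = 0" and "continuous_on UNIV k"
    using assms by (auto simp: Cc_def)
  then have "integrable lborel (\<lambda>x. indicator K x *\<^sub>R k x)"
    by (intro borel_integrable_compact) (auto intro: continuous_on_subset)
  moreover have "(\<lambda>x. indicator K x *\<^sub>R k x) = k"
    using K(2) by (auto simp: fun_eq_iff split: split_indicator)
  ultimately show ?thesis by simp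
qed

lemma Cc_power2:
  assumes "Cc k"
  shows "Cc (\<lambda>x. (k x)\<^sup>2)"
proof -
  obtain K where K: "compact K" "\<And>x. x \<notin> K \<Longrightarrow> k x = 0" "continuous_on UNIV k"
    using assms by (auto simp: Cc_def)
  then show ?thesis
    unfolding Cc_def by (intro conjI exI[of _ K] continuous_on_power) auto
qed

text \<open>Used with s = 1 and s = -1, since \<open>k (y - x)\<close> has to be an admissible
  kernel in y as well as in x.\<close>

lemma Cc_affine:
  assumes "Cc k" "s \<noteq> 0"
  shows "Cc (\<lambda>x. k (s *\<^sub>R x + c))"
proof -
  obtain K where K: "compact K" "\<And>x. x \<notin> K \<Longrightarrow> k x = 0" and k: "continuous_on UNIV k"
    using assms by (auto simp: Cc_def)
  have "compact ((\<lambda>y. (1 / s) *\<^sub>R (y - c)) ` K)"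
    using K(1) by (intro compact_continuous_image continuous_intros)
  moreover have "k (s *\<^sub>R x + c) = 0" if "x \<notin> (\<lambda>y. (1 / s) *\<^sub>R (y - c)) ` K" for x
  proof (rule K(2))
    show "s *\<^sub>R x + c \<notin> K"
    proof
      assume "s *\<^sub>R x + c \<in> K"
      then have "(1 / s) *\<^sub>R (s *\<^sub>R x + c - c) \<in> (\<lambda>y. (1 / s) *\<^sub>R (y - c)) ` K" by (rule imageI)
      with that \<open>s \<noteq> 0\<close> show False by simp
    qed
  qed
  moreover have "continuous_on UNIV (\<lambda>x. k (s *\<^sub>R x + c))"
    by (rule continuous_on_compose2[OF k]) (auto intro!: continuous_intros)
  ultimately show ?thesis unfolding Cc_def by blast
qed

lemma integrable_Cc_scaleR:
  assumes "Cc k" "L2_fun p"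
  shows "integrable lborel (\<lambda>x. k x *\<^sub>R p x)"
  using assms by (intro integrable_scaleR_L2 Cc_borel Cc_integrable Cc_power2)

lemma test_function_Cc:
  assumes "test_function \<phi>"
  shows "Cc \<phi>" "i \<in> Basis \<Longrightarrow> Cc (\<lambda>x. frechet_derivative \<phi> (at x) i)"
proof -
  obtain K where K: "compact K" "\<forall>x. x \<notin> K \<longrightarrow> \<phi> x = 0 \<and> frechet_derivative \<phi> (at x) i = 0"
    using test_functionD(4)[OF assms] by blast
  show "Cc \<phi>" "i \<in> Basis \<Longrightarrow> Cc (\<lambda>x. frechet_derivative \<phi> (at x) i)"
    unfolding Cc_def using K test_functionD(1,3)[OF assms] by blast+
qed

lemma frechet_derivative_affine:
  fixes f :: "'a::euclidean_space \<Rightarrow> real"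
  assumes "f differentiable at (s *\<^sub>R x + c)"
  shows "(\<lambda>x. f (s *\<^sub>R x + c)) differentiable at x"
    "frechet_derivative (\<lambda>x. f (s *\<^sub>R x + c)) (at x) i = s * frechet_derivative f (at (s *\<^sub>R x + c)) i"
proof -
  let ?f' = "frechet_derivative f (at (s *\<^sub>R x + c))"
  have f': "(f has_derivative ?f') (at (s *\<^sub>R x + c))"
    using assms by (simp add: frechet_derivative_works)
  have "((\<lambda>x. s *\<^sub>R x + c) has_derivative (\<lambda>h. s *\<^sub>R h)) (at x)"
    by (auto intro!: derivative_eq_intros)
  from has_derivative_compose[OF this f']
  have d: "((\<lambda>x. f (s *\<^sub>R x + c)) has_derivative (\<lambda>h. ?f' (s *\<^sub>R h))) (at x)" .
  then show "(\<lambda>x. f (s *\<^sub>R x + c)) differentiable at x"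
    unfolding differentiable_def by blast
  have "?f' (s *\<^sub>R i) = s * ?f' i"
    using linear_cmul[OF has_derivative_linear[OF f']] by simp
  then show "frechet_derivative (\<lambda>x. f (s *\<^sub>R x + c)) (at x) i = s * ?f' i"
    by (simp add: frechet_derivative_at[OF d, symmetric])
qed

lemma Ck_affine: "Ck k f \<Longrightarrow> Ck k (\<lambda>x. f (s *\<^sub>R x + c))"
proof (induction k arbitrary: f)
  case 0
  then have "continuous_on UNIV f" by simp
  then have "continuous_on UNIV (\<lambda>x. f (s *\<^sub>R x + c))"
    by (rule continuous_on_compose2) (auto intro!: continuous_intros)
  then show ?case by simp
next
  case (Suc k)
  then have d: "f differentiable at x" for x
    by (auto simp: differentiable_on_def)
  have "Ck k (\<lambda>x. s * frechet_derivative f (at (s *\<^sub>R x + c)) i)" if "i \<in> Basis" for i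
    using Suc that by (intro Ck_mult Ck_const) auto
  then show ?case
    using frechet_derivative_affine[OF d] by (auto simp: differentiable_on_def)
qed

lemma test_function_affine:
  assumes "test_function \<phi>" "s \<noteq> 0"
  shows "test_function (\<lambda>x. \<phi> (s *\<^sub>R x + c))"
proof -
  have "Cc (\<lambda>x. \<phi> (s *\<^sub>R x + c))"
    using assms by (intro Cc_affine test_function_Cc)
  then obtain K where K: "compact K" "\<And>x. x \<notin> K \<Longrightarrow> \<phi> (s *\<^sub>R x + c) = 0"
    unfolding Cc_def by blast
  then have "{x. \<phi> (s *\<^sub>R x + c) \<noteq> 0} \<subseteq> K" by blast
  then have "bounded {x. \<phi> (s *\<^sub>R x + c) \<noteq> 0}"
    using K(1) by (meson bounded_subset compact_imp_bounded)
  then show ?thesis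
    using assms(1) Ck_affine unfolding test_function_def compact_closure by blast
qed

section \<open>Correlations of L^2 functions and their smearing by a kernel\<close>

lemma nn_integral_translate:
  fixes f :: "'a::euclidean_space \<Rightarrow> ennreal"
  assumes "f \<in> borel_measurable borel"
  shows "(\<integral>\<^sup>+x. f (x + c) \<partial>lborel) = (\<integral>\<^sup>+x. f x \<partial>lborel)"
  using assms by (subst (2) lborel_distr_plus[of c, symmetric]) (simp add: nn_integral_distr add.commute)

text \<open>The bound is uniform in z because translation preserves the L^2 norm; this is what makes
  the double integrals below finite.\<close>

lemma correlation_bound:
  assumes "L2_fun p" "L2_fun q"
  shows "(\<integral>x. \<bar>p (x + z) \<bullet> q x\<bar> \<partial>lborel)
    \<le> (\<integral>x. (norm (p x))\<^sup>2 \<partial>lborel) + (\<integral>x. (norm (q x))\<^sup>2 \<partial>lborel)"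
proof -
  have i: "integrable lborel (\<lambda>x. (norm (p (x + z)))\<^sup>2)" "integrable lborel (\<lambda>x. (norm (q x))\<^sup>2)"
    using assms by (auto intro: L2_funD L2_fun_translate)
  have le: "\<bar>p (x + z) \<bullet> q x\<bar> \<le> (norm (p (x + z)))\<^sup>2 + (norm (q x))\<^sup>2" for x
    using Cauchy_Schwarz_ineq2[of "p (x + z)" "q x"] sum_squares_bound[of "norm (p (x + z))" "norm (q x)"]
      zero_le_power2[of "norm (p (x + z))"] zero_le_power2[of "norm (q x)"] by linarith
  have "(\<integral>x. \<bar>p (x + z) \<bullet> q x\<bar> \<partial>lborel) \<le> (\<integral>x. (norm (p (x + z)))\<^sup>2 + (norm (q x))\<^sup>2 \<partial>lborel)"
    using i le integrable_inner_L2[OF L2_fun_translate[OF assms(1)] assms(2)]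
    by (intro integral_mono) auto
  also have "\<dots> = (\<integral>x. (norm (p (x + z)))\<^sup>2 \<partial>lborel) + (\<integral>x. (norm (q x))\<^sup>2 \<partial>lborel)"
    using i by simp
  also have "(\<integral>x. (norm (p (x + z)))\<^sup>2 \<partial>lborel) = (\<integral>x. (norm (p x))\<^sup>2 \<partial>lborel)"
    by (rule integral_translate)
  finally show ?thesis .
qed

lemma integrable_kernel:
  assumes k: "Cc k" and p: "L2_fun p" and q: "L2_fun q"
  shows "integrable (lborel \<Otimes>\<^sub>M lborel) (\<lambda>(z, x). k z * (p (x + z) \<bullet> q x))"
    and "integrable (lborel \<Otimes>\<^sub>M lborel) (\<lambda>(x, y). k (y - x) * (p y \<bullet> q x))"
proof -
  note [measurable] = Cc_borel[OF k] L2_funD(1)[OF p] L2_funD(1)[OF q]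
  let ?M = "(\<integral>x. (norm (p x))\<^sup>2 \<partial>lborel) + (\<integral>x. (norm (q x))\<^sup>2 \<partial>lborel)"
  have i: "integrable lborel (\<lambda>x. p (x + z) \<bullet> q x)" for z
    by (intro integrable_inner_L2 L2_fun_translate p q)
  show int1: "integrable (lborel \<Otimes>\<^sub>M lborel) (\<lambda>(z, x). k z * (p (x + z) \<bullet> q x))"
  proof (rule lborel_pair.Fubini_integrable)
    show "AE z in lborel. integrable lborel (\<lambda>x. (\<lambda>(z, x). k z * (p (x + z) \<bullet> q x)) (z, x))"
      using i by simp
    show "integrable lborel (\<lambda>z. \<integral>x. norm ((\<lambda>(z, x). k z * (p (x + z) \<bullet> q x)) (z, x)) \<partial>lborel)"
    proof (rule Bochner_Integration.integrable_bound)
      show "integrable lborel (\<lambda>z. k z * ?M)"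
        using Cc_integrable[OF k] by simp
      show "AE z in lborel. norm (\<integral>x. norm ((\<lambda>(z, x). k z * (p (x + z) \<bullet> q x)) (z, x)) \<partial>lborel)
          \<le> norm (k z * ?M)"
      proof (rule AE_I2)
        fix z
        have "(\<integral>x. \<bar>p (x + z) \<bullet> q x\<bar> \<partial>lborel) \<le> \<bar>?M\<bar>"
          using correlation_bound[OF p q, of z] by linarith
        then show "norm (\<integral>x. norm ((\<lambda>(z, x). k z * (p (x + z) \<bullet> q x)) (z, x)) \<partial>lborel) \<le> norm (k z * ?M)"
          by (simp add: abs_mult mult_left_mono)
      qed
    qed measurable
  qed measurable
  show "integrable (lborel \<Otimes>\<^sub>M lborel) (\<lambda>(x, y). k (y - x) * (p y \<bullet> q x))"
  \<comment> \<open>The substitution y = x + z in the inner integral, followed by Tonelli, turns the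
    norm integral of this kernel into that of the first one.\<close>
  proof (rule integrableI_bounded)
    have "(\<integral>\<^sup>+w. ennreal (norm ((\<lambda>(x, y). k (y - x) * (p y \<bullet> q x)) w)) \<partial>(lborel \<Otimes>\<^sub>M lborel))
        = (\<integral>\<^sup>+x. \<integral>\<^sup>+y. ennreal \<bar>k (y - x) * (p y \<bullet> q x)\<bar> \<partial>lborel \<partial>lborel)"
      by (subst lborel.nn_integral_fst[symmetric]) auto
    also have "\<dots> = (\<integral>\<^sup>+x. \<integral>\<^sup>+z. ennreal \<bar>k z * (p (x + z) \<bullet> q x)\<bar> \<partial>lborel \<partial>lborel)"
    proof (rule nn_integral_cong)
      fix x
      show "(\<integral>\<^sup>+y. ennreal \<bar>k (y - x) * (p y \<bullet> q x)\<bar> \<partial>lborel)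
          = (\<integral>\<^sup>+z. ennreal \<bar>k z * (p (x + z) \<bullet> q x)\<bar> \<partial>lborel)"
        using nn_integral_translate[of "\<lambda>y. ennreal \<bar>k (y - x) * (p y \<bullet> q x)\<bar>" x]
        by (simp add: add.commute)
    qed
    also have "\<dots> = (\<integral>\<^sup>+z. \<integral>\<^sup>+x. ennreal \<bar>k z * (p (x + z) \<bullet> q x)\<bar> \<partial>lborel \<partial>lborel)"
      by (rule lborel_pair.Fubini') measurable
    also have "\<dots> = (\<integral>\<^sup>+w. ennreal (norm ((\<lambda>(z, x). k z * (p (x + z) \<bullet> q x)) w)) \<partial>(lborel \<Otimes>\<^sub>M lborel))"
      by (subst lborel.nn_integral_fst[symmetric]) auto
    also have "\<dots> < \<infinity>"
      using int1 by (simp add: integrable_iff_bounded)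
    finally show "(\<integral>\<^sup>+w. ennreal (norm ((\<lambda>(x, y). k (y - x) * (p y \<bullet> q x)) w)) \<partial>(lborel \<Otimes>\<^sub>M lborel)) < \<infinity>" .
  qed measurable
qed

text \<open>The smeared correlation can be read as k acting on p or as k acting on q. Passing from
  one reading to the other transports a derivative from one factor, through the kernel, to the other
  factor.\<close>

lemma kernel_integral:
  assumes k: "Cc k" and p: "L2_fun p" and q: "L2_fun q"
  shows "(\<integral>x. (\<integral>y. k (y - x) *\<^sub>R p y \<partial>lborel) \<bullet> q x \<partial>lborel)
      = (\<integral>z. k z * (\<integral>x. p (x + z) \<bullet> q x \<partial>lborel) \<partial>lborel)" (is "?L1 = ?R")
    and "(\<integral>y. p y \<bullet> (\<integral>x. k (y - x) *\<^sub>R q x \<partial>lborel) \<partial>lborel)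
      = (\<integral>z. k z * (\<integral>x. p (x + z) \<bullet> q x \<partial>lborel) \<partial>lborel)" (is "?L2 = ?R")
proof -
  have k1: "Cc (\<lambda>y. k (y - x))" and k2: "Cc (\<lambda>y. k (x - y))" for x
    using Cc_affine[OF k, of 1 "- x"] Cc_affine[OF k, of "- 1" x] by simp_all
  have "?L1 = (\<integral>x. (\<integral>y. k (y - x) * (p y \<bullet> q x) \<partial>lborel) \<partial>lborel)"
    using integrable_Cc_scaleR[OF k1 p]
    by (intro Bochner_Integration.integral_cong[OF refl]) (simp_all flip: integral_inner_left)
  also have "\<dots> = (\<integral>x. (\<integral>z. k z * (p (x + z) \<bullet> q x) \<partial>lborel) \<partial>lborel)"
  proof (rule Bochner_Integration.integral_cong[OF refl])
    fix x
    show "(\<integral>y. k (y - x) * (p y \<bullet> q x) \<partial>lborel) = (\<integral>z. k z * (p (x + z) \<bullet> q x) \<partial>lborel)"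
      using integral_translate[of "\<lambda>y. k (y - x) * (p y \<bullet> q x)" x]
      by (simp add: add.commute)
  qed
  also have "\<dots> = (\<integral>z. (\<integral>x. k z * (p (x + z) \<bullet> q x) \<partial>lborel) \<partial>lborel)"
    by (rule lborel_pair.Fubini_integral[OF integrable_kernel(1)[OF assms]])
  also have "\<dots> = ?R" by simp
  finally show L1: "?L1 = ?R" .
  have "?L2 = (\<integral>y. (\<integral>x. k (y - x) * (p y \<bullet> q x) \<partial>lborel) \<partial>lborel)"
    using integrable_Cc_scaleR[OF k2 q]
    by (intro Bochner_Integration.integral_cong[OF refl]) (simp_all flip: integral_inner_right)
  also have "\<dots> = (\<integral>x. (\<integral>y. k (y - x) * (p y \<bullet> q x) \<partial>lborel) \<partial>lborel)"
    by (rule lborel_pair.Fubini_integral[OF integrable_kernel(2)[OF assms]])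
  also have "\<dots> = ?L1"
    using integrable_Cc_scaleR[OF k1 p]
    by (intro Bochner_Integration.integral_cong[OF refl]) (simp_all flip: integral_inner_left)
  finally show "?L2 = ?R" using L1 by simp
qed

text \<open>If f a were nonzero, f would be nonzero on a whole neighbourhood of a, and a nonempty
  open set is not negligible.\<close>

lemma continuous_AE_zero:
  fixes f :: "'a::euclidean_space \<Rightarrow> real"
  assumes "AE x in lborel. f x = 0" "isCont f a"
  shows "f a = 0"
proof (rule ccontr)
  assume "f a \<noteq> 0"
  then have "\<forall>\<^sub>F x in nhds a. f x \<noteq> 0"
    using assms(2) by (intro tendsto_imp_eventually_ne[of f "f a" "nhds a"]) (simp_all add: isCont_def tendsto_at_iff_tendsto_nhds)
  then obtain S where S: "open S" "a \<in> S" "\<And>x. x \<in> S \<Longrightarrow> f x \<noteq> 0"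
    unfolding eventually_nhds by blast
  have "AE x in lborel. x \<notin> S"
    using assms(1) by eventually_elim (use S(3) in blast)
  then have "S \<in> null_sets lborel"
    using S(1) by (subst AE_iff_null_sets) auto
  then have "negligible S"
    by (simp add: negligible_iff_null_sets null_sets_completionI)
  then show False
    using open_not_negligible S by blast
qed

lemma weak_deriv_by_parts:
  assumes u: "has_weak_deriv i u g" and w: "has_weak_deriv i w h" and i: "i \<in> Basis"
  shows "(\<integral>x. h x \<bullet> u x \<partial>lborel) = - (\<integral>x. w x \<bullet> g x \<partial>lborel)"
proof -
  have L2: "L2_fun u" "L2_fun g" "L2_fun w" "L2_fun h"
    using u w by (auto simp: has_weak_deriv_def)
  note [measurable] = L2[THEN L2_funD(1)]
  \<comment> \<open>At z = 0 this is the difference of the two sides of the claim.\<close>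
  define \<Phi> where "\<Phi> z = (\<integral>x. h (x + z) \<bullet> u x \<partial>lborel) + (\<integral>x. w (x + z) \<bullet> g x \<partial>lborel)" for z
  have [measurable]: "(\<lambda>z. \<integral>x. h (x + z) \<bullet> u x \<partial>lborel) \<in> borel_measurable borel"
      "(\<lambda>z. \<integral>x. w (x + z) \<bullet> g x \<partial>lborel) \<in> borel_measurable borel"
    by measurable
  obtain M1 where M1: "\<bar>\<integral>x. h (x + z) \<bullet> u x \<partial>lborel\<bar> \<le> M1" for z
    using that order.trans[OF integral_abs_bound correlation_bound[OF L2(4,1)]] by blast
  obtain M2 where M2: "\<bar>\<integral>x. w (x + z) \<bullet> g x \<partial>lborel\<bar> \<le> M2" for z
    using that order.trans[OF integral_abs_bound correlation_bound[OF L2(3,2)]] by blast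
  \<comment> \<open>Applied with f a box indicator for the local integrability that the fundamental
    lemma asks for, and with f = \<open>\<rho>\<close> to split the integral of
    \<open>\<rho> z * \<Phi> z\<close>.\<close>
  have loc: "integrable lborel (\<lambda>z. f z * F z)"
    if "integrable lborel f" "F \<in> borel_measurable borel" "\<And>z. \<bar>F z\<bar> \<le> M" for f F :: "'a \<Rightarrow> real" and M
  proof (rule Bochner_Integration.integrable_bound[of lborel "\<lambda>z. f z * M"])
    have "\<bar>F z\<bar> \<le> \<bar>M\<bar>" for z using that(3)[of z] by linarith
    then show "AE z in lborel. norm (f z * F z) \<le> norm (f z * M)"
      by (intro AE_I2) (simp add: abs_mult mult_left_mono)
  qed (use that in auto)
  have "AE z in lborel. \<Phi> z = 0"
  proof (rule fundamental_lemma)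
    show "\<Phi> \<in> borel_measurable borel" unfolding \<Phi>_def by measurable
    show "integrable lborel (\<lambda>x. indicator (box a b) x * \<Phi> x)" for a b
      unfolding \<Phi>_def distrib_left
      by (intro Bochner_Integration.integrable_add loc[OF _ _ M1] loc[OF _ _ M2])
         (auto simp: integrable_indicator_iff less_top[symmetric] emeasure_lborel_box_eq)
    fix \<rho> :: "'a \<Rightarrow> real" assume \<rho>: "test_function \<rho>"
    define \<rho>' where "\<rho>' z = frechet_derivative \<rho> (at z) i" for z
    have Cc: "Cc \<rho>" "Cc \<rho>'"
      unfolding \<rho>'_def using test_function_Cc[OF \<rho>] i by auto
    have aff: "frechet_derivative (\<lambda>x. \<rho> (s *\<^sub>R x + c)) (at y) i = s * \<rho>' (s *\<^sub>R y + c)" for s c y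
      unfolding \<rho>'_def by (intro frechet_derivative_affine test_functionD(2)[OF \<rho>])
    have eq1: "(\<integral>y. \<rho> (y - x) *\<^sub>R h y \<partial>lborel) = - (\<integral>y. \<rho>' (y - x) *\<^sub>R w y \<partial>lborel)" for x
    proof -
      have "test_function (\<lambda>y. \<rho> (1 *\<^sub>R y + (- x)))"
        using \<rho> by (intro test_function_affine) auto
      with w have "(\<integral>y. frechet_derivative (\<lambda>y. \<rho> (1 *\<^sub>R y + (- x))) (at y) i *\<^sub>R w y \<partial>lborel)
          = - (\<integral>y. \<rho> (1 *\<^sub>R y + (- x)) *\<^sub>R h y \<partial>lborel)"
        unfolding has_weak_deriv_def by blast
      then show ?thesis unfolding aff by simp
    qed
    \<comment> \<open>Here the test function is reflected as well as shifted; the sign from the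
      reflection cancels the sign in the definition of the weak derivative, unlike in
      \<open>eq1\<close>.\<close>
    have eq2: "(\<integral>x. \<rho>' (y - x) *\<^sub>R u x \<partial>lborel) = (\<integral>x. \<rho> (y - x) *\<^sub>R g x \<partial>lborel)" for y
    proof -
      have "test_function (\<lambda>x. \<rho> ((- 1) *\<^sub>R x + y))"
        using \<rho> by (intro test_function_affine) auto
      with u have "(\<integral>x. frechet_derivative (\<lambda>x. \<rho> ((- 1) *\<^sub>R x + y)) (at x) i *\<^sub>R u x \<partial>lborel)
          = - (\<integral>x. \<rho> ((- 1) *\<^sub>R x + y) *\<^sub>R g x \<partial>lborel)"
        unfolding has_weak_deriv_def by blast
      then show ?thesis unfolding aff by simp
    qed
    \<comment> \<open>First k = \<open>\<rho>\<close> acts on h and \<open>eq1\<close> moves the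
      derivative to \<open>\<rho>\<close>; then k = \<open>\<rho>'\<close> is read as acting on u,
      and \<open>eq2\<close> moves the derivative on to g.\<close>
    have "(\<integral>z. \<rho> z * (\<integral>x. h (x + z) \<bullet> u x \<partial>lborel) \<partial>lborel)
        = - (\<integral>z. \<rho>' z * (\<integral>x. w (x + z) \<bullet> u x \<partial>lborel) \<partial>lborel)"
      using L2 Cc by (simp add: kernel_integral(1)[symmetric] eq1)
    also have "\<dots> = - (\<integral>z. \<rho> z * (\<integral>x. w (x + z) \<bullet> g x \<partial>lborel) \<partial>lborel)"
      using L2 Cc by (simp add: kernel_integral(2)[symmetric] eq2)
    finally have "(\<integral>z. \<rho> z * (\<integral>x. h (x + z) \<bullet> u x \<partial>lborel) \<partial>lborel)
        + (\<integral>z. \<rho> z * (\<integral>x. w (x + z) \<bullet> g x \<partial>lborel) \<partial>lborel) = 0"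
      by simp
    moreover have "integrable lborel (\<lambda>z. \<rho> z * (\<integral>x. h (x + z) \<bullet> u x \<partial>lborel))"
        "integrable lborel (\<lambda>z. \<rho> z * (\<integral>x. w (x + z) \<bullet> g x \<partial>lborel))"
      by (intro loc[OF _ _ M1] loc[OF _ _ M2] Cc_integrable Cc; measurable)+
    ultimately show "(\<integral>z. \<rho> z * \<Phi> z \<partial>lborel) = 0"
      by (simp add: \<Phi>_def distrib_left)
  qed
  moreover have "isCont \<Phi> 0"
    unfolding \<Phi>_def by (intro continuous_intros correlation_isCont_0 L2)
  ultimately have "\<Phi> 0 = 0" by (rule continuous_AE_zero)
  then show ?thesis by (simp add: \<Phi>_def)
qed

subsection \<open>Scaling and the action\<close>

text \<open>The fundamental lemma is about real functions, so it is applied to the components of the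
  difference; e = 1 and e = \<i> recover the real and the imaginary part.\<close>

lemma weak_deriv_unique:
  assumes "has_weak_deriv i u g" "has_weak_deriv i u g'"
  shows "AE x in lborel. g x = g' x"
proof -
  define d where "d x = g x - g' x" for x
  have L2: "L2_fun g" "L2_fun g'"
    using assms by (auto simp: has_weak_deriv_def)
  then have d: "L2_fun d"
    unfolding d_def by (rule L2_fun_diff)
  note [measurable] = L2_funD(1)[OF d]
  have zero: "AE x in lborel. d x \<bullet> e = 0" for e
  proof (rule fundamental_lemma)
    show "integrable lborel (\<lambda>x. indicator (box a b) x * (d x \<bullet> e))" for a b
    proof -
      have "integrable lborel (\<lambda>x. (indicator (box a b) x)\<^sup>2 :: real)"
        by (simp add: power2_eq_square flip: indicator_inter_arith)
           (simp add: integrable_indicator_iff less_top[symmetric] emeasure_lborel_box_eq)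
      then have "integrable lborel (\<lambda>x. indicator (box a b) x *\<^sub>R d x)"
        using d by (intro integrable_scaleR_L2) auto
      then have "integrable lborel (\<lambda>x. (indicator (box a b) x *\<^sub>R d x) \<bullet> e)"
        by (rule integrable_inner_left)
      then show ?thesis by simp
    qed
    fix \<phi> :: "'a \<Rightarrow> real" assume \<phi>: "test_function \<phi>"
    have i: "integrable lborel (\<lambda>x. \<phi> x *\<^sub>R g x)" "integrable lborel (\<lambda>x. \<phi> x *\<^sub>R g' x)"
        "integrable lborel (\<lambda>x. \<phi> x *\<^sub>R d x)"
      using L2 d test_function_Cc(1)[OF \<phi>] by (auto intro: integrable_Cc_scaleR)
    have "(\<integral>x. \<phi> x *\<^sub>R g x \<partial>lborel) = (\<integral>x. \<phi> x *\<^sub>R g' x \<partial>lborel)"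
      using assms \<phi> unfolding has_weak_deriv_def by (metis neg_equal_iff_equal)
    then have "(\<integral>x. \<phi> x *\<^sub>R d x \<partial>lborel) = 0"
      using i(1,2) by (simp add: d_def scaleR_diff_right)
    then have "(\<integral>x. (\<phi> x *\<^sub>R d x) \<bullet> e \<partial>lborel) = 0"
      using i(3) by (subst integral_inner_left) simp_all
    then show "(\<integral>x. \<phi> x * (d x \<bullet> e) \<partial>lborel) = 0" by simp
  qed simp
  from zero[of 1] zero[of \<i>] show ?thesis
    by eventually_elim (simp add: d_def inner_complex_def complex_eq_iff)
qed

text \<open>Needed for second derivatives: the function differentiated the second time is a chosen
  representative, known only up to a null set.\<close>

lemma weak_deriv_cong_AE:
  assumes u: "has_weak_deriv i u g" and i: "i \<in> Basis"
    and u': "L2_fun u'" "AE x in lborel. u x = u' x"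
  shows "has_weak_deriv i u' g"
  unfolding has_weak_deriv_def
proof (intro conjI allI impI)
  show "L2_fun g" using u by (simp add: has_weak_deriv_def)
  fix \<phi> :: "'a \<Rightarrow> real" assume \<phi>: "test_function \<phi>"
  have [measurable]: "u \<in> borel_measurable borel" "u' \<in> borel_measurable borel"
      "(\<lambda>x. frechet_derivative \<phi> (at x) i) \<in> borel_measurable borel"
    using u u' Cc_borel[OF test_function_Cc(2)[OF \<phi> i]]
    by (auto simp: has_weak_deriv_def dest: L2_funD(1))
  have "(\<integral>x. frechet_derivative \<phi> (at x) i *\<^sub>R u' x \<partial>lborel)
      = (\<integral>x. frechet_derivative \<phi> (at x) i *\<^sub>R u x \<partial>lborel)"
    using u'(2) by (intro integral_cong_AE) (auto elim: eventually_mono)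
  then show "(\<integral>x. frechet_derivative \<phi> (at x) i *\<^sub>R u' x \<partial>lborel) = - (\<integral>x. \<phi> x *\<^sub>R g x \<partial>lborel)"
    using u \<phi> by (simp add: has_weak_deriv_def)
qed (rule u')

lemma weak_deriv_scaleR:
  assumes "has_weak_deriv i u g"
  shows "has_weak_deriv i (\<lambda>x. c *\<^sub>R u x) (\<lambda>x. c *\<^sub>R g x)"
proof -
  have "(\<integral>x. k x *\<^sub>R c *\<^sub>R f x \<partial>lborel) = c *\<^sub>R (\<integral>x. k x *\<^sub>R f x \<partial>lborel)"
    for k :: "'a \<Rightarrow> real" and f :: "'a \<Rightarrow> complex"
    by (subst scaleR_left_commute) (rule integral_scaleR_right)
  then show ?thesis
    using assms unfolding has_weak_deriv_def by (auto intro: L2_fun_scaleR)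
qed

lemma has_weak_deriv_wderiv: "has_weak_deriv i u g \<Longrightarrow> has_weak_deriv i u (wderiv i u)"
  unfolding wderiv_def by (rule someI[where P = "has_weak_deriv i u"])

lemma H2D:
  assumes "u \<in> H2"
  shows "L2_fun u"
    and "i \<in> Basis \<Longrightarrow> has_weak_deriv i u (wderiv i u)"
    and "i \<in> Basis \<Longrightarrow> j \<in> Basis \<Longrightarrow> has_weak_deriv j (wderiv i u) (wderiv j (wderiv i u))"
  using assms unfolding H2_def by (auto intro: has_weak_deriv_wderiv)

lemma L2_fun_wderiv:
  assumes "u \<in> H2" "i \<in> Basis"
  shows "L2_fun (wderiv i u)" "j \<in> Basis \<Longrightarrow> L2_fun (wderiv j (wderiv i u))"
  using H2D[OF assms(1)] assms(2) by (auto simp: has_weak_deriv_def)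

lemma L2_fun_laplacian: "u \<in> H2 \<Longrightarrow> L2_fun (laplacian u)"
  unfolding laplacian_def[abs_def] by (intro L2_fun_sum L2_fun_wderiv) auto

text \<open>\<open>wderiv\<close> picks representatives, so it commutes with scaling only almost
  everywhere. The first-order identity comes from uniqueness; it is then transferred to the
  representative chosen for \<open>cu\<close>, after which uniqueness applies again at second
  order.\<close>

lemma scaleR_wderiv:
  fixes c :: real
  assumes u: "u \<in> H2" and i: "i \<in> Basis" and j: "j \<in> Basis"
  defines "cu \<equiv> \<lambda>x. c *\<^sub>R u x"
  shows "has_weak_deriv i cu (\<lambda>x. c *\<^sub>R wderiv i u x)"
    and "has_weak_deriv j (wderiv i cu) (\<lambda>x. c *\<^sub>R wderiv j (wderiv i u) x)"
    and "AE x in lborel. wderiv j (wderiv i cu) x = c *\<^sub>R wderiv j (wderiv i u) x"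
proof -
  show 1: "has_weak_deriv i cu (\<lambda>x. c *\<^sub>R wderiv i u x)"
    unfolding cu_def using u i by (intro weak_deriv_scaleR H2D)
  have 2: "has_weak_deriv i cu (wderiv i cu)"
    using 1 by (rule has_weak_deriv_wderiv)
  show 3: "has_weak_deriv j (wderiv i cu) (\<lambda>x. c *\<^sub>R wderiv j (wderiv i u) x)"
  proof (rule weak_deriv_cong_AE)
    show "has_weak_deriv j (\<lambda>x. c *\<^sub>R wderiv i u x) (\<lambda>x. c *\<^sub>R wderiv j (wderiv i u) x)"
      using u i j by (intro weak_deriv_scaleR H2D)
    show "L2_fun (wderiv i cu)" using 2 by (simp add: has_weak_deriv_def)
    show "AE x in lborel. c *\<^sub>R wderiv i u x = wderiv i cu x"
      using 1 2 by (rule weak_deriv_unique)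
  qed fact
  show "AE x in lborel. wderiv j (wderiv i cu) x = c *\<^sub>R wderiv j (wderiv i u) x"
    using has_weak_deriv_wderiv[OF 3] 3 by (rule weak_deriv_unique)
qed

lemma H2_scaleR:
  assumes "u \<in> H2"
  shows "(\<lambda>x. c *\<^sub>R u x) \<in> H2"
  using scaleR_wderiv[OF assms] L2_fun_scaleR[OF H2D(1)[OF assms]]
  unfolding H2_def by blast

lemma laplacian_scaleR:
  assumes "u \<in> H2"
  shows "AE x in lborel. laplacian (\<lambda>x. c *\<^sub>R u x) x = c *\<^sub>R laplacian u x"
proof -
  have "AE x in lborel. \<forall>i\<in>Basis. wderiv i (wderiv i (\<lambda>x. c *\<^sub>R u x)) x = c *\<^sub>R wderiv i (wderiv i u) x"
    using scaleR_wderiv(3)[OF assms] by (subst AE_finite_all) auto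
  then show ?thesis
    by eventually_elim (simp add: laplacian_def scaleR_sum_right)
qed

section \<open>The functionals under scaling, and the action in terms of q and the mass\<close>

lemma Lp_norm_2_power2: "(Lp_norm 2 u)\<^sup>2 = (\<integral>x. (norm (u x))\<^sup>2 \<partial>lborel)"
proof -
  have "(\<integral>x. norm (u x) powr 2 \<partial>lborel) = (\<integral>x. (norm (u x))\<^sup>2 \<partial>lborel)"
    by (intro Bochner_Integration.integral_cong) (auto simp: powr_numeral)
  then show ?thesis
    by (simp add: Lp_norm_def powr_half_sqrt)
qed

lemma mass_eq: "mass u = (\<integral>x. (norm (u x))\<^sup>2 \<partial>lborel)"
  unfolding mass_def by (rule Lp_norm_2_power2)

lemma mass_scaleR: "mass (\<lambda>x. c *\<^sub>R u x) = c\<^sup>2 * mass u"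
  by (simp add: mass_eq power_mult_distrib)

lemma Lp_norm_scaleR:
  assumes "p \<noteq> 0"
  shows "Lp_norm p (\<lambda>x. c *\<^sub>R u x) = \<bar>c\<bar> * Lp_norm p u"
  using assms by (simp add: Lp_norm_def powr_mult powr_powr)

lemma q11_nonneg: "0 \<le> q11 u"
  by (simp add: q11_def)

lemma q11_scaleR:
  assumes "u \<in> H2"
  shows "q11 (\<lambda>x. c *\<^sub>R u x) = c\<^sup>2 * q11 u"
proof -
  note [measurable] = L2_funD(1)[OF L2_fun_laplacian[OF assms]] L2_funD(1)[OF H2D(1)[OF assms]]
    L2_funD(1)[OF L2_fun_laplacian[OF H2_scaleR[OF assms]]]
  have "q11 (\<lambda>x. c *\<^sub>R u x) = (\<integral>x. c\<^sup>2 * (norm (laplacian u x + u x))\<^sup>2 \<partial>lborel)"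
    unfolding q11_def Lp_norm_2_power2
  proof (rule integral_cong_AE)
    show "AE x in lborel. (norm (laplacian (\<lambda>x. c *\<^sub>R u x) x + c *\<^sub>R u x))\<^sup>2
        = c\<^sup>2 * (norm (laplacian u x + u x))\<^sup>2"
      using laplacian_scaleR[OF assms, of c]
      by eventually_elim (simp add: power_mult_distrib flip: scaleR_add_right)
  qed measurable
  then show ?thesis by (simp add: q11_def Lp_norm_2_power2)
qed

lemma mass_pos:
  assumes "u \<in> H2" "nonzero u"
  shows "0 < mass u"
proof -
  have i: "integrable lborel (\<lambda>x. (norm (u x))\<^sup>2)"
    using L2_funD(2)[OF H2D(1)[OF assms(1)]] .
  have "mass u \<noteq> 0"
    using assms(2) unfolding mass_eq nonzero_def by (subst integral_nonneg_eq_0_iff_AE[OF i]) auto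
  moreover have "0 \<le> mass u" by (simp add: mass_eq)
  ultimately show ?thesis by simp
qed

text \<open>Integration by parts in each coordinate, with \<open>wderiv i u\<close> in the roles of
  both w and g.\<close>

lemma integral_laplacian_inner:
  assumes "u \<in> H2"
  shows "(\<integral>x. laplacian u x \<bullet> u x \<partial>lborel) = - (grad_norm u)\<^sup>2"
proof -
  note L2 = H2D(1)[OF assms] L2_fun_wderiv[OF assms]
  have "(\<integral>x. laplacian u x \<bullet> u x \<partial>lborel) = (\<Sum>i\<in>Basis. \<integral>x. wderiv i (wderiv i u) x \<bullet> u x \<partial>lborel)"
    unfolding laplacian_def inner_sum_left
    using L2 by (intro Bochner_Integration.integral_sum integrable_inner_L2) auto
  also have "\<dots> = (\<Sum>i\<in>Basis. - (\<integral>x. (norm (wderiv i u x))\<^sup>2 \<partial>lborel))"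
    unfolding power2_norm_eq_inner
    by (intro sum.cong refl weak_deriv_by_parts[OF H2D(2)[OF assms] H2D(3)[OF assms]])
  also have "\<dots> = - (\<integral>x. (\<Sum>i\<in>Basis. (norm (wderiv i u x))\<^sup>2) \<partial>lborel)"
    using L2(2)[THEN L2_funD(2)] by (subst Bochner_Integration.integral_sum) (auto simp: sum_negf)
  also have "(\<integral>x. (\<Sum>i\<in>Basis. (norm (wderiv i u x))\<^sup>2) \<partial>lborel) = (grad_norm u)\<^sup>2"
    by (simp add: grad_norm_def sum_nonneg)
  finally show ?thesis .
qed

lemma q11_eq:
  assumes "u \<in> H2"
  shows "q11 u = (Lp_norm 2 (laplacian u))\<^sup>2 - 2 * (grad_norm u)\<^sup>2 + mass u"
proof -
  note L2 = H2D(1)[OF assms] L2_fun_laplacian[OF assms]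
  have "q11 u = (\<integral>x. (norm (laplacian u x))\<^sup>2 + 2 * (laplacian u x \<bullet> u x) + (norm (u x))\<^sup>2 \<partial>lborel)"
    unfolding q11_def Lp_norm_2_power2 power2_norm_eq_inner
    by (simp add: inner_add_left inner_add_right inner_commute algebra_simps)
  also have "\<dots> = (\<integral>x. (norm (laplacian u x))\<^sup>2 \<partial>lborel) + 2 * (\<integral>x. laplacian u x \<bullet> u x \<partial>lborel) + mass u"
    using L2_funD(2)[OF L2(1)] L2_funD(2)[OF L2(2)] integrable_inner_L2[OF L2(2,1)]
    by (simp add: mass_eq)
  finally show ?thesis
    by (simp add: integral_laplacian_inner[OF assms] Lp_norm_2_power2)
qed

text \<open>Half the numerator of the quotient appears, so for a rescaled optimizer the action
  becomes a function of \<open>R e\<close> alone.\<close>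

lemma action_eq:
  assumes "u \<in> H2"
  shows "action \<alpha> (1 + e) u
    = 1 / 2 * (q11 u + e * mass u) - 1 / (\<alpha> + 2) * Lp_norm (\<alpha> + 2) u powr (\<alpha> + 2)"
  unfolding action_def q11_eq[OF assms] mass_def by (simp add: field_simps)

subsection \<open>Functions with a supergradient\<close>

text \<open>To be read with R the infimum and m the mass of the normalized optimizer. Then R is the
  value of q at the optimizer plus e * m e, and \<open>m_le\<close> expresses that q is
  nonnegative.\<close>

locale supergradient =
  fixes R m :: "real \<Rightarrow> real" and \<epsilon>\<^sub>0 :: real
  assumes \<epsilon>\<^sub>0_pos: "0 < \<epsilon>\<^sub>0"
    and supergradient: "\<And>e e'. e \<in> {0<..<\<epsilon>\<^sub>0} \<Longrightarrow> e' \<in> {0<..<\<epsilon>\<^sub>0} \<Longrightarrow> R e' \<le> R e + (e' - e) * m e"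
    and m_pos: "\<And>e. e \<in> {0<..<\<epsilon>\<^sub>0} \<Longrightarrow> 0 < m e"
    and m_le: "\<And>e. e \<in> {0<..<\<epsilon>\<^sub>0} \<Longrightarrow> e * m e \<le> R e"
begin

lemma R_pos: "e \<in> {0<..<\<epsilon>\<^sub>0} \<Longrightarrow> 0 < R e"
  using m_le[of e] m_pos[of e] by (auto intro: less_le_trans[rotated])

text \<open>The supergradient at the left endpoint bounds the slope from above, the one at the right
  endpoint from below.\<close>

lemma slope_bounds:
  assumes "0 < e1" "e1 < e2" "e2 < \<epsilon>\<^sub>0"
  shows "m e2 \<le> (R e2 - R e1) / (e2 - e1)" "(R e2 - R e1) / (e2 - e1) \<le> m e1"
  using supergradient[of e1 e2] supergradient[of e2 e1] assms
  by (auto simp: field_simps)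

lemma R_strict_mono: "strict_mono_on {0<..<\<epsilon>\<^sub>0} R"
proof (rule strict_mono_onI)
  fix e1 e2 assume e: "e1 \<in> {0<..<\<epsilon>\<^sub>0}" "e2 \<in> {0<..<\<epsilon>\<^sub>0}" "e1 < e2"
  then have "(e1 - e2) * m e2 < 0"
    using m_pos[of e2] by (simp add: mult_neg_pos)
  with supergradient[OF e(2,1)] show "R e1 < R e2" by simp
qed

lemma m_antimono: "antimono_on {0<..<\<epsilon>\<^sub>0} m"
proof (rule monotone_onI)
  fix e1 e2 assume "e1 \<in> {0<..<\<epsilon>\<^sub>0}" "e2 \<in> {0<..<\<epsilon>\<^sub>0}" "e1 \<le> e2"
  then show "m e2 \<le> m e1"
    using slope_bounds[of e1 e2] by (cases "e1 = e2") auto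
qed

text \<open>The line with slope \<open>m ?e\<close> through the intermediate point lies above R at x
  and y; averaging with the weights u and v cancels its linear part.\<close>

lemma R_concave: "concave_on {0<..<\<epsilon>\<^sub>0} R"
  unfolding concave_on_iff
proof (intro conjI ballI allI impI)
  fix x y u v :: real
  assume xy: "x \<in> {0<..<\<epsilon>\<^sub>0}" "y \<in> {0<..<\<epsilon>\<^sub>0}" and uv: "0 \<le> u" "0 \<le> v" "u + v = 1"
  let ?e = "u *\<^sub>R x + v *\<^sub>R y"
  have e: "?e \<in> {0<..<\<epsilon>\<^sub>0}"
    using convexD[OF convex_real_interval(8)] xy uv by blast
  have "u * R x + v * R y \<le> u * (R ?e + (x - ?e) * m ?e) + v * (R ?e + (y - ?e) * m ?e)"
    using supergradient[OF e xy(1)] supergradient[OF e xy(2)] uv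
    by (intro add_mono mult_left_mono) auto
  also have "\<dots> = (u + v) * R ?e + (u * x + v * y - (u + v) * ?e) * m ?e"
    by (simp add: algebra_simps)
  also have "\<dots> = R ?e" by (simp add: uv(3))
  finally show "u * R x + v * R y \<le> R ?e" .
qed simp

text \<open>Subtracting the supergradient line leaves a function with a maximum at e, whose
  derivative therefore vanishes.\<close>

lemma R_derivative:
  assumes e: "e \<in> {0<..<\<epsilon>\<^sub>0}" and "R differentiable (at e)"
  shows "(R has_real_derivative m e) (at e)"
proof -
  obtain D where D: "(R has_real_derivative D) (at e)"
    using assms(2) by (auto simp: real_differentiable_def)
  have "((\<lambda>x. R x - m e * x) has_real_derivative D - m e) (at e)"
    by (auto intro!: derivative_eq_intros D)
  moreover obtain d where "0 < d" "\<And>y. \<bar>e - y\<bar> < d \<Longrightarrow> y \<in> {0<..<\<epsilon>\<^sub>0}"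
  proof
    show "0 < min e (\<epsilon>\<^sub>0 - e)" using e by simp
  qed (use e in auto)
  moreover have "R y - m e * y \<le> R e - m e * e" if "y \<in> {0<..<\<epsilon>\<^sub>0}" for y
    using supergradient[OF e that] by (simp add: algebra_simps)
  ultimately have "D - m e = 0"
    by (intro DERIV_local_max) auto
  with D show ?thesis by simp
qed

lemma eventually_in_range:
  assumes "0 < t"
  shows "\<forall>\<^sub>F e in at_right 0. t * e \<in> {0<..<\<epsilon>\<^sub>0}"
proof -
  have "\<forall>\<^sub>F e in at_right 0. e \<in> {0<..<\<epsilon>\<^sub>0 / t}"
    using assms \<epsilon>\<^sub>0_pos by (intro eventually_at_rightI[of 0 "\<epsilon>\<^sub>0 / t"]) auto
  then show ?thesis
    by eventually_elim (use assms in \<open>auto simp: field_simps\<close>)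
qed

text \<open>The source of all asymptotics: t > 1 bounds the fraction e * m e / R e from below, t < 1
  bounds it from above.\<close>

lemma dilation_bound:
  assumes e: "e \<in> {0<..<\<epsilon>\<^sub>0}" and te: "t * e \<in> {0<..<\<epsilon>\<^sub>0}"
  shows "R (t * e) / R e - 1 \<le> (t - 1) * (e * m e / R e)"
proof -
  have "R (t * e) - R e \<le> (t - 1) * (e * m e)"
    using supergradient[OF assms] by (simp add: algebra_simps)
  then have "(R (t * e) - R e) / R e \<le> (t - 1) * (e * m e) / R e"
    using R_pos[OF e] by (intro divide_right_mono) auto
  then show ?thesis
    using R_pos[OF e] by (simp add: diff_divide_distrib)
qed

text \<open>
  Comparing \<open>R\<close> at \<open>\<epsilon>\<close> and at a large multiple \<open>t \<epsilon>\<close>: the power \<open>t powr \<gamma>\<close> beats both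
  comparability constants, so the increment of \<open>R\<close>, hence \<open>\<epsilon> * m \<epsilon>\<close>, is at least \<open>R \<epsilon>\<close> up to a factor.
\<close>

lemma m_comparable:
  assumes \<gamma>: "0 < \<gamma>" and L: "slowly_varying_at_0 L" and R: "R \<approx> (\<lambda>e. e powr \<gamma> * L e)"
  shows "m \<approx> (\<lambda>e. R e / e)"
proof -
  obtain c C where c: "0 < c" "c < C"
    and RL: "\<forall>\<^sub>F e in at_right 0. c * (e powr \<gamma> * L e) \<le> R e \<and> R e \<le> C * (e powr \<gamma> * L e)"
    using R unfolding comparable_def by blast
  \<comment> \<open>This t makes \<open>t powr \<gamma>\<close> equal to 4C/c. The ratio C/c pays
    for the comparability constants and a factor 2 for L (t e) > L e / 2; the remaining 2 gives R (t
    e) \<ge> 2 R e.\<close>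
  define t where "t = (4 * C / c) powr (1 / \<gamma>)"
  have C: "0 < C" and ratio: "4 < 4 * C / c" using c by (simp_all add: field_simps)
  have t\<gamma>: "t powr \<gamma> = 4 * C / c"
    using \<gamma> C c by (simp add: t_def powr_powr)
  have t: "1 < t"
    using \<gamma> ratio unfolding t_def by (intro gr_one_powr) auto
  have RLt: "\<forall>\<^sub>F e in at_right 0. c * ((t * e) powr \<gamma> * L (t * e)) \<le> R (t * e)"
  proof -
    have "filterlim (\<lambda>e. t * e) (at_right 0) (at_right 0)"
      using t by real_asymp
    from eventually_compose_filterlim[OF RL this] show ?thesis
      by eventually_elim simp
  qed
  have Lt: "\<forall>\<^sub>F e in at_right 0. 1 / 2 < L (t * e) / L e"
    using L t unfolding slowly_varying_at_0_def by (intro order_tendstoD(1)[of _ 1]) auto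
  have Lpos: "\<forall>\<^sub>F e in at_right 0. 0 < L e"
    using L by (simp add: slowly_varying_at_0_def)
  have range: "\<forall>\<^sub>F e in at_right 0. e \<in> {0<..<\<epsilon>\<^sub>0} \<and> t * e \<in> {0<..<\<epsilon>\<^sub>0}"
    using eventually_conj[OF eventually_in_range[of 1] eventually_in_range[of t]] t by simp
  \<comment> \<open>By \<open>m_le\<close> the upper bound holds with constant 1; adding 1/(t - 1)
    makes it exceed the lower constant, as \<open>comparable\<close> demands c < C.\<close>
  have main: "\<forall>\<^sub>F e in at_right 0. 1 / (t - 1) * (R e / e) \<le> m e \<and> m e \<le> (1 + 1 / (t - 1)) * (R e / e)"
    using RL RLt Lt Lpos range
  proof eventually_elim
    case (elim e)
    then have e: "e \<in> {0<..<\<epsilon>\<^sub>0}" and te: "t * e \<in> {0<..<\<epsilon>\<^sub>0}" and "0 < e" by auto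
    have pow: "(t * e) powr \<gamma> = 4 * C / c * e powr \<gamma>"
      using t \<open>0 < e\<close> by (simp add: powr_mult t\<gamma>)
    have "2 * R e \<le> 2 * (C * (e powr \<gamma> * L e))"
      using elim by simp
    also have "\<dots> = 4 * C * e powr \<gamma> * (L e / 2)" by simp
    also have "\<dots> \<le> 4 * C * e powr \<gamma> * L (t * e)"
      using elim C by (intro mult_left_mono) (auto simp: field_simps)
    also have "\<dots> = c * ((t * e) powr \<gamma> * L (t * e))"
      using c by (simp add: pow)
    also have "\<dots> \<le> R (t * e)" using elim by simp
    finally have "2 \<le> R (t * e) / R e"
      using R_pos[OF e] by (simp add: field_simps)
    with dilation_bound[OF e te] have "1 \<le> (t - 1) * (e * m e / R e)" by linarith
    then have "1 / (t - 1) * (R e / e) \<le> m e"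
      using t \<open>0 < e\<close> R_pos[OF e] by (simp add: field_simps)
    moreover have "m e \<le> R e / e"
      using m_le[OF e] \<open>0 < e\<close> by (simp add: field_simps)
    moreover have "0 \<le> 1 / (t - 1) * (R e / e)"
      using t \<open>0 < e\<close> R_pos[OF e] by simp
    ultimately show ?case unfolding distrib_right by linarith
  qed
  show ?thesis
    unfolding comparable_def using main t
    by (intro exI[of _ "1 / (t - 1)"] exI[of _ "1 + 1 / (t - 1)"]) auto
qed

text \<open>For fixed t the dilation bound passes to the limit e to 0: the slope (t^\<gamma> - 1)/(t
  - 1) is a lower bound for the limit inferior if t > 1 and an upper bound for the limit superior if
  t < 1. As t tends to 1 these slopes tend to \<gamma>, the derivative of t^\<gamma> at 1. So for
  each a a suitable t is fixed first, and e is sent to 0 afterwards.\<close>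

lemma mass_fraction_limit:
  assumes reg: "\<And>t. 0 < t \<Longrightarrow> ((\<lambda>e. R (t * e) / R e) \<longlongrightarrow> t powr \<gamma>) (at_right 0)"
  shows "((\<lambda>e. e * m e / R e) \<longlongrightarrow> \<gamma>) (at_right 0)"
proof -
  have "((\<lambda>t. t powr \<gamma>) has_real_derivative \<gamma>) (at 1)"
    by (auto intro!: derivative_eq_intros)
  then have slope: "((\<lambda>t. (t powr \<gamma> - 1) / (t - 1)) \<longlongrightarrow> \<gamma>) (at 1)"
    by (simp add: has_field_derivative_iff)
  have bound: "\<forall>\<^sub>F e in at_right 0. R (t * e) / R e - 1 \<le> (t - 1) * (e * m e / R e)" if "0 < t" for t
    using eventually_in_range[OF zero_less_one] eventually_in_range[OF that]
    by eventually_elim (rule dilation_bound, simp_all)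
  have lim: "((\<lambda>e. (R (t * e) / R e - 1) / (t - 1)) \<longlongrightarrow> (t powr \<gamma> - 1) / (t - 1)) (at_right 0)"
    if "0 < t" "t \<noteq> 1" for t
    using that by (intro tendsto_divide tendsto_diff tendsto_const reg) auto
  show ?thesis
  proof (rule order_tendstoI)
    fix a assume "a < \<gamma>"
    have "\<forall>\<^sub>F t in at_right 1. a < (t powr \<gamma> - 1) / (t - 1)"
      using order_tendstoD(1)[OF slope \<open>a < \<gamma>\<close>] by (rule eventually_at_split[THEN iffD1, THEN conjunct2])
    then have "\<forall>\<^sub>F t in at_right 1. a < (t powr \<gamma> - 1) / (t - 1) \<and> 1 < t"
      using eventually_at_right_less by (rule eventually_conj)
    then obtain t where t: "a < (t powr \<gamma> - 1) / (t - 1)" "1 < t"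
      using eventually_happens'[OF trivial_limit_at_right_real] by blast
    from order_tendstoD(1)[OF lim t(1)] t(2)
    have "\<forall>\<^sub>F e in at_right 0. a < (R (t * e) / R e - 1) / (t - 1)" by simp
    then show "\<forall>\<^sub>F e in at_right 0. a < e * m e / R e"
      using bound[of t, OF order.strict_trans[OF zero_less_one t(2)]]
    proof eventually_elim
      case (elim e)
      have "(R (t * e) / R e - 1) / (t - 1) \<le> e * m e / R e"
        using elim(2) t(2) by (subst pos_divide_le_eq) (auto simp: mult.commute)
      with elim(1) show ?case by linarith
    qed
  next
    fix a assume "\<gamma> < a"
    have "\<forall>\<^sub>F t in at_left 1. (t powr \<gamma> - 1) / (t - 1) < a"
      using order_tendstoD(2)[OF slope \<open>\<gamma> < a\<close>] by (rule eventually_at_split[THEN iffD1, THEN conjunct1])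
    then have "\<forall>\<^sub>F t in at_left 1. (t powr \<gamma> - 1) / (t - 1) < a \<and> t \<in> {0<..<1}"
      by (rule eventually_conj) (intro eventually_at_leftI[of 0], auto)
    then obtain t where t: "(t powr \<gamma> - 1) / (t - 1) < a" "0 < t" "t < 1"
      using eventually_happens'[OF trivial_limit_at_left_real] by fastforce
    from order_tendstoD(2)[OF lim t(1)] t(2,3)
    have "\<forall>\<^sub>F e in at_right 0. (R (t * e) / R e - 1) / (t - 1) < a" by simp
    then show "\<forall>\<^sub>F e in at_right 0. e * m e / R e < a"
      using bound[OF t(2)]
    proof eventually_elim
      case (elim e)
      have "e * m e / R e \<le> (R (t * e) / R e - 1) / (t - 1)"
        using elim(2) t(3) by (subst neg_le_divide_eq) (auto simp: mult.commute)
      with elim(1) show ?case by linarith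
    qed
  qed
qed

end

section \<open>Arithmetic of the relation \<approx>\<close>

lemma comparable_mult:
  fixes A B f :: "real \<Rightarrow> real"
  assumes "A \<approx> B" "\<forall>\<^sub>F e in at_right 0. 0 < f e"
  shows "(\<lambda>e. f e * A e) \<approx> (\<lambda>e. f e * B e)"
proof -
  obtain c C where c: "0 < c" "c < C" and AB: "\<forall>\<^sub>F e in at_right 0. c * B e \<le> A e \<and> A e \<le> C * B e"
    using assms(1) unfolding comparable_def by blast
  have "\<forall>\<^sub>F e in at_right 0. c * (f e * B e) \<le> f e * A e \<and> f e * A e \<le> C * (f e * B e)"
    using AB assms(2)
    by eventually_elim (simp add: mult.left_commute[of _ "f _"] mult_left_mono)
  with c show ?thesis unfolding comparable_def by blast
qed

lemma comparable_cong:
  fixes A B A' B' :: "real \<Rightarrow> real"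
  assumes "A \<approx> B" "\<forall>\<^sub>F e in at_right 0. A e = A' e" "\<forall>\<^sub>F e in at_right 0. B e = B' e"
  shows "A' \<approx> B'"
proof -
  obtain c C where c: "0 < c" "c < C" and AB: "\<forall>\<^sub>F e in at_right 0. c * B e \<le> A e \<and> A e \<le> C * B e"
    using assms(1) unfolding comparable_def by blast
  have "\<forall>\<^sub>F e in at_right 0. c * B' e \<le> A' e \<and> A' e \<le> C * B' e"
    using AB assms(2,3) by eventually_elim simp
  with c show ?thesis unfolding comparable_def by blast
qed

lemma comparable_powr:
  fixes A B :: "real \<Rightarrow> real"
  assumes "A \<approx> B" "\<forall>\<^sub>F e in at_right 0. 0 \<le> B e" "0 < p"
  shows "(\<lambda>e. A e powr p) \<approx> (\<lambda>e. B e powr p)"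
proof -
  obtain c C where c: "0 < c" "c < C" and AB: "\<forall>\<^sub>F e in at_right 0. c * B e \<le> A e \<and> A e \<le> C * B e"
    using assms(1) unfolding comparable_def by blast
  have "\<forall>\<^sub>F e in at_right 0. c powr p * B e powr p \<le> A e powr p \<and> A e powr p \<le> C powr p * B e powr p"
    using AB assms(2)
  proof eventually_elim
    case (elim e)
    then have "(c * B e) powr p \<le> A e powr p" "A e powr p \<le> (C * B e) powr p"
      using c assms(3) by (auto intro!: powr_mono2 intro: order.trans[of 0 "c * B e"])
    with c elim show ?case by (simp add: powr_mult)
  qed
  moreover have "c powr p < C powr p"
    using c assms(3) by (intro powr_less_mono2) auto
  ultimately show ?thesis
    unfolding comparable_def using c by (intro exI[of _ "c powr p"] exI[of _ "C powr p"]) simp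
qed

section \<open>Application to the minimization problem\<close>

theorem theorem3p4:
  fixes X :: "('a::euclidean_space \<Rightarrow> complex) set"
    and \<alpha> \<epsilon>\<^sub>0 :: real
    and v Q :: "real \<Rightarrow> 'a \<Rightarrow> complex"
    and R :: "real \<Rightarrow> real"
  assumes "0 < \<alpha>"
    and "DIM('a) \<ge> 5 \<Longrightarrow> \<alpha> < 8 / (real DIM('a) - 4)"
    and "symmetry_class X"
    and "0 < \<epsilon>\<^sub>0"
    and "\<And>\<epsilon>. \<epsilon> \<in> {0<..<\<epsilon>\<^sub>0} \<Longrightarrow> \<exists>u. optimizer X \<alpha> \<epsilon> u"
    and "\<And>\<epsilon>. \<epsilon> \<in> {0<..<\<epsilon>\<^sub>0} \<Longrightarrow> optimizer X \<alpha> \<epsilon> (v \<epsilon>) \<and> Lp_norm (\<alpha> + 2) (v \<epsilon>) = 1"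
  defines "R \<equiv> Rinf X \<alpha>"
    and "Q \<equiv> rescaled X \<alpha> v"
  shows
    "(strict_mono_on {0<..<\<epsilon>\<^sub>0} R \<and> concave_on {0<..<\<epsilon>\<^sub>0} R \<and>
      (\<forall>\<epsilon>\<^sub>1 \<epsilon>\<^sub>2. 0 < \<epsilon>\<^sub>1 \<longrightarrow> \<epsilon>\<^sub>1 < \<epsilon>\<^sub>2 \<longrightarrow> \<epsilon>\<^sub>2 < \<epsilon>\<^sub>0 \<longrightarrow>
         mass (v \<epsilon>\<^sub>2) \<le> (R \<epsilon>\<^sub>2 - R \<epsilon>\<^sub>1) / (\<epsilon>\<^sub>2 - \<epsilon>\<^sub>1) \<and>
         (R \<epsilon>\<^sub>2 - R \<epsilon>\<^sub>1) / (\<epsilon>\<^sub>2 - \<epsilon>\<^sub>1) \<le> mass (v \<epsilon>\<^sub>1)) \<and>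
      antimono_on {0<..<\<epsilon>\<^sub>0} (\<lambda>\<epsilon>. mass (v \<epsilon>)) \<and>
      (\<forall>\<epsilon>\<in>{0<..<\<epsilon>\<^sub>0}. R differentiable (at \<epsilon>) \<longrightarrow>
         (R has_real_derivative mass (v \<epsilon>)) (at \<epsilon>) \<and>
         ((\<lambda>e. action \<alpha> (1 + e) (Q e)) has_real_derivative 1 / 2 * mass (Q \<epsilon>)) (at \<epsilon>)))
     \<and>
     (\<forall>\<gamma> L. 0 < \<gamma> \<and> \<gamma> < 1 \<and> slowly_varying_at_0 L \<and> R \<approx> (\<lambda>\<epsilon>. \<epsilon> powr \<gamma> * L \<epsilon>) \<longrightarrow>
        ((\<lambda>\<epsilon>. mass (Q \<epsilon>)) \<approx> (\<lambda>\<epsilon>. R \<epsilon> powr ((\<alpha> + 2) / \<alpha>) / \<epsilon>) \<and>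
         (\<lambda>\<epsilon>. R \<epsilon> powr ((\<alpha> + 2) / \<alpha>) / \<epsilon>) \<approx>
           (\<lambda>\<epsilon>. \<epsilon> powr (\<gamma> * ((\<alpha> + 2) / \<alpha>) - 1) * L \<epsilon> powr ((\<alpha> + 2) / \<alpha>)))
        \<and>
        ((\<forall>t>0. ((\<lambda>\<epsilon>. R (t * \<epsilon>) / R \<epsilon>) \<longlongrightarrow> t powr \<gamma>) (at_right 0)) \<longrightarrow>
           (\<lambda>\<epsilon>. \<epsilon> * mass (Q \<epsilon>)) \<sim>[at_right 0] (\<lambda>\<epsilon>. \<gamma> * R \<epsilon> powr ((\<alpha> + 2) / \<alpha>)) \<and>
           (\<lambda>\<epsilon>. \<epsilon> * mass (Q \<epsilon>)) \<sim>[at_right 0]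
             (\<lambda>\<epsilon>. \<gamma> * Lp_norm (\<alpha> + 2) (Q \<epsilon>) powr (\<alpha> + 2)) \<and>
           (\<lambda>\<epsilon>. q11 (Q \<epsilon>)) \<sim>[at_right 0]
             (\<lambda>\<epsilon>. (1 - \<gamma>) * Lp_norm (\<alpha> + 2) (Q \<epsilon>) powr (\<alpha> + 2))))"
proof -
  let ?I = "{0<..<\<epsilon>\<^sub>0}" and ?p = "(\<alpha> + 2) / \<alpha>"
  define m where "m e = mass (v e)" for e
  have XH2: "X \<subseteq> H2"
    using assms(3) by (auto simp: symmetry_class_def H2_invariant_def)
  have opt: "v e \<in> X" "nonzero (v e)" "quotient \<alpha> e (v e) = R e" "Lp_norm (\<alpha> + 2) (v e) = 1"
    if "e \<in> ?I" for e
    using assms(6)[OF that] by (simp_all add: optimizer_def R_def)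
  have vH2: "v e \<in> H2" if "e \<in> ?I" for e
    using opt(1)[OF that] XH2 by blast
  have R_eq: "R e = q11 (v e) + e * m e" if "e \<in> ?I" for e
    using opt(3,4)[OF that] by (simp add: quotient_def m_def)
  have quotient_nonneg: "0 \<le> quotient \<alpha> e u" if "0 < e" for e u
    using that by (auto simp: quotient_def q11_nonneg mass_eq intro!: divide_nonneg_nonneg add_nonneg_nonneg)
  have R_le: "R e \<le> q11 (v d) + e * m d" if "e \<in> ?I" "d \<in> ?I" for e d
  proof -
    have "R e \<le> quotient \<alpha> e (v d)"
      unfolding R_def Rinf_def
    proof (rule cINF_lower)
      \<comment> \<open>An infimum of reals is a lower bound only if the set is bounded below; 0
        serves because the quotient is nonnegative for positive e.\<close>
      show "bdd_below (quotient \<alpha> e ` {u \<in> X. nonzero u})"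
        using quotient_nonneg that(1) by (intro bdd_belowI[of _ 0]) auto
    qed (use opt(1,2)[OF that(2)] in simp)
    then show ?thesis
      using opt(4)[OF that(2)] by (simp add: quotient_def m_def)
  qed
  interpret supergradient R m \<epsilon>\<^sub>0
  proof
    \<comment> \<open>Both \<open>R_le\<close> at e' and \<open>R_eq\<close> at e contain the same
      \<open>q11 (v e)\<close>, which cancels.\<close>
    show "R e' \<le> R e + (e' - e) * m e" if "e \<in> ?I" "e' \<in> ?I" for e e'
      using R_le[OF that(2,1)] R_eq[OF that(1)] by (simp add: algebra_simps)
    show "0 < m e" if "e \<in> ?I" for e
      unfolding m_def using that by (intro mass_pos vH2 opt)
    show "e * m e \<le> R e" if "e \<in> ?I" for e
      using R_eq[OF that] q11_nonneg[of "v e"] by simp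
  qed fact
  have Q: "Q e = (\<lambda>x. (R e powr (1 / \<alpha>)) *\<^sub>R v e x)" for e
    by (simp add: Q_def rescaled_def R_def)
  have QH2: "Q e \<in> H2" if "e \<in> ?I" for e
    unfolding Q by (intro H2_scaleR vH2 that)
  have sq: "(R e powr (1 / \<alpha>))\<^sup>2 = R e powr (2 / \<alpha>)" for e
    by (simp add: power2_eq_square flip: powr_add)
  \<comment> \<open>Quadratic functionals of \<open>Q e\<close> carry the squared scaling factor, R
    to the power 2/\<alpha>. One more factor R gives the exponent \<open>?p\<close>, which is also
    that of the nonlinear term, (1/\<alpha>)(\<alpha> + 2).\<close>
  have p: "?p = 2 / \<alpha> + 1" using \<open>0 < \<alpha>\<close> by (simp add: field_simps)
  have massQ: "mass (Q e) = R e powr (2 / \<alpha>) * m e" for e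
    by (simp add: Q mass_scaleR sq m_def)
  have qQ: "q11 (Q e) = R e powr (2 / \<alpha>) * (R e - e * m e)" if "e \<in> ?I" for e
    unfolding Q q11_scaleR[OF vH2[OF that]] sq using R_eq[OF that] by simp
  have Rp: "R e powr ?p = R e powr (2 / \<alpha>) * R e" if "e \<in> ?I" for e
    using R_pos[OF that] by (simp add: p powr_add)
  have LpQ: "Lp_norm (\<alpha> + 2) (Q e) powr (\<alpha> + 2) = R e powr ?p" if "e \<in> ?I" for e
    using \<open>0 < \<alpha>\<close> opt(4)[OF that] by (simp add: Q Lp_norm_scaleR powr_powr)
  have action: "action \<alpha> (1 + e) (Q e) = (1 / 2 - 1 / (\<alpha> + 2)) * R e powr ?p" if "e \<in> ?I" for e
    unfolding action_eq[OF QH2[OF that]] LpQ[OF that] qQ[OF that] massQ Rp[OF that]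
    by (simp add: algebra_simps)
  \<comment> \<open>Differentiating the action brings down the exponent \<open>?p\<close>; its
    product with the prefactor is the 1/2 in front of the mass.\<close>
  have coeff: "(1 / 2 - 1 / (\<alpha> + 2)) * ?p = 1 / 2"
  proof -
    have "(1 / 2 - 1 / (\<alpha> + 2)) * (\<alpha> + 2) = \<alpha> / 2"
      using \<open>0 < \<alpha>\<close> by (simp add: left_diff_distrib add_divide_distrib)
    then have "(1 / 2 - 1 / (\<alpha> + 2)) * (\<alpha> + 2) / \<alpha> = 1 / 2"
      using \<open>0 < \<alpha>\<close> by simp
    then show ?thesis by (simp only: times_divide_eq_right)
  qed
  have derivative: "(R has_real_derivative m e) (at e)"
      "((\<lambda>e. action \<alpha> (1 + e) (Q e)) has_real_derivative 1 / 2 * mass (Q e)) (at e)"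
    if e: "e \<in> ?I" and "R differentiable (at e)" for e
  proof -
    show der: "(R has_real_derivative m e) (at e)"
      using that by (rule R_derivative)
    have "((\<lambda>e. (1 / 2 - 1 / (\<alpha> + 2)) * R e powr ?p) has_real_derivative
        (1 / 2 - 1 / (\<alpha> + 2)) * (?p * R e powr (?p - 1) * m e)) (at e)"
      using DERIV_fun_powr[OF der R_pos[OF e], of ?p] by (intro DERIV_cmult) simp
    also have "(1 / 2 - 1 / (\<alpha> + 2)) * (?p * R e powr (?p - 1) * m e)
        = ((1 / 2 - 1 / (\<alpha> + 2)) * ?p) * (R e powr (2 / \<alpha>) * m e)"
      by (simp add: p)
    also have "\<dots> = 1 / 2 * mass (Q e)"
      unfolding coeff massQ ..
    \<comment> \<open>The closed form of the action is available only on the interval of existence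
      of the optimizers; that interval is open, so the derivative carries over.\<close>
    finally show "((\<lambda>e. action \<alpha> (1 + e) (Q e)) has_real_derivative 1 / 2 * mass (Q e)) (at e)"
      by (rule has_field_derivative_transform_within_open[where S = ?I]) (use e action in auto)
  qed
  have ev: "\<forall>\<^sub>F e in at_right 0. e \<in> ?I"
    using eventually_in_range[of 1] by simp
  have part_ii: "(\<lambda>e. mass (Q e)) \<approx> (\<lambda>e. R e powr ?p / e) \<and>
      (\<lambda>e. R e powr ?p / e) \<approx> (\<lambda>e. e powr (\<gamma> * ?p - 1) * L e powr ?p)"
    if \<gamma>: "0 < \<gamma>" and L: "slowly_varying_at_0 L" and RL: "R \<approx> (\<lambda>e. e powr \<gamma> * L e)" for \<gamma> L
  proof
    have "(\<lambda>e. R e powr (2 / \<alpha>) * m e) \<approx> (\<lambda>e. R e powr (2 / \<alpha>) * (R e / e))"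
      using m_comparable[OF that] by (rule comparable_mult) (use ev in eventually_elim, use R_pos in force)
    then show "(\<lambda>e. mass (Q e)) \<approx> (\<lambda>e. R e powr ?p / e)"
      by (rule comparable_cong) (use ev in \<open>eventually_elim, simp add: massQ Rp\<close>)+
    have Lpos: "\<forall>\<^sub>F e in at_right 0. 0 < L e"
      using L by (simp add: slowly_varying_at_0_def)
    have pos: "\<forall>\<^sub>F e in at_right (0::real). 0 < 1 / e"
      using ev by eventually_elim simp
    have "0 < ?p" using \<open>0 < \<alpha>\<close> by simp
    have "(\<lambda>e. R e powr ?p) \<approx> (\<lambda>e. (e powr \<gamma> * L e) powr ?p)"
      using RL by (rule comparable_powr) (use Lpos \<open>0 < ?p\<close> in \<open>auto elim: eventually_mono\<close>)
    from comparable_mult[OF this pos]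
    show "(\<lambda>e. R e powr ?p / e) \<approx> (\<lambda>e. e powr (\<gamma> * ?p - 1) * L e powr ?p)"
    proof (rule comparable_cong)
      show "\<forall>\<^sub>F e in at_right 0. 1 / e * (e powr \<gamma> * L e) powr ?p = e powr (\<gamma> * ?p - 1) * L e powr ?p"
        using ev Lpos
      proof eventually_elim
        case (elim e)
        then have "(e powr \<gamma> * L e) powr ?p = e powr (\<gamma> * ?p) * L e powr ?p"
          by (simp add: powr_mult powr_powr)
        with elim show ?case by (simp add: powr_diff)
      qed
    qed simp
  qed
  have part_iii: "(\<lambda>e. e * mass (Q e)) \<sim>[at_right 0] (\<lambda>e. \<gamma> * R e powr ?p)"
      "(\<lambda>e. e * mass (Q e)) \<sim>[at_right 0] (\<lambda>e. \<gamma> * Lp_norm (\<alpha> + 2) (Q e) powr (\<alpha> + 2))"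
      "(\<lambda>e. q11 (Q e)) \<sim>[at_right 0] (\<lambda>e. (1 - \<gamma>) * Lp_norm (\<alpha> + 2) (Q e) powr (\<alpha> + 2))"
    if \<gamma>: "0 < \<gamma>" "\<gamma> < 1"
      and reg: "\<And>t. 0 < t \<Longrightarrow> ((\<lambda>e. R (t * e) / R e) \<longlongrightarrow> t powr \<gamma>) (at_right 0)" for \<gamma>
  proof -
    note lim = mass_fraction_limit[OF reg]
    have "((\<lambda>e. (e * m e / R e) / \<gamma>) \<longlongrightarrow> \<gamma> / \<gamma>) (at_right 0)"
      using \<gamma> by (intro tendsto_divide lim tendsto_const) auto
    then have "((\<lambda>e. (e * m e / R e) / \<gamma>) \<longlongrightarrow> 1) (at_right 0)"
      using \<gamma> by simp
    then show 1: "(\<lambda>e. e * mass (Q e)) \<sim>[at_right 0] (\<lambda>e. \<gamma> * R e powr ?p)"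
      by (intro asymp_equivI', elim Lim_transform_eventually)
         (use ev in eventually_elim, use R_pos in \<open>force simp: massQ Rp\<close>)
    have Lp: "\<forall>\<^sub>F e in at_right 0. c * R e powr ?p = c * Lp_norm (\<alpha> + 2) (Q e) powr (\<alpha> + 2)" for c
      using ev by eventually_elim (simp add: LpQ)
    show "(\<lambda>e. e * mass (Q e)) \<sim>[at_right 0] (\<lambda>e. \<gamma> * Lp_norm (\<alpha> + 2) (Q e) powr (\<alpha> + 2))"
      using 1 asymp_equiv_refl_ev[OF Lp] by (rule asymp_equiv_trans)
    \<comment> \<open>Since R e is the sum of \<open>q11 (v e)\<close> and e * m e, the fraction
      left for q tends to 1 - \<gamma>, which is nonzero by \<gamma> < 1.\<close>
    have "((\<lambda>e. (1 - e * m e / R e) / (1 - \<gamma>)) \<longlongrightarrow> (1 - \<gamma>) / (1 - \<gamma>)) (at_right 0)"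
      using \<gamma> by (intro tendsto_divide tendsto_diff lim tendsto_const) auto
    then have "((\<lambda>e. (1 - e * m e / R e) / (1 - \<gamma>)) \<longlongrightarrow> 1) (at_right 0)"
      using \<gamma> by simp
    moreover have "\<forall>\<^sub>F e in at_right 0.
        (1 - e * m e / R e) / (1 - \<gamma>) = q11 (Q e) / ((1 - \<gamma>) * R e powr ?p)"
      using ev
    proof eventually_elim
      case (elim e)
      then have "1 - e * m e / R e = (R e - e * m e) / R e"
        using R_pos[of e] by (simp add: diff_divide_distrib)
      then show ?case
        using R_pos[OF elim] by (simp add: qQ[OF elim] Rp[OF elim])
    qed
    ultimately have "(\<lambda>e. q11 (Q e)) \<sim>[at_right 0] (\<lambda>e. (1 - \<gamma>) * R e powr ?p)"
      by (intro asymp_equivI') (rule Lim_transform_eventually)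
    then show "(\<lambda>e. q11 (Q e)) \<sim>[at_right 0] (\<lambda>e. (1 - \<gamma>) * Lp_norm (\<alpha> + 2) (Q e) powr (\<alpha> + 2))"
      using asymp_equiv_refl_ev[OF Lp] by (rule asymp_equiv_trans)
  qed
  show ?thesis
  proof (intro conjI allI impI ballI)
  qed (use R_strict_mono R_concave slope_bounds m_antimono derivative part_ii part_iii in
      \<open>auto simp flip: m_def\<close>)
qed

end
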